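(* Let $m\in\mathbb{C}\setminus\{-1\}$ and $n\in\mathbb{N}$. Then $$\sum_{k=1}^{n}k^{m}=\frac{1}{m+1}n^{m+1}+\zeta(-m)+\frac{n^{m+1}}{m+1}\sum_{k=1}^{\infty}\frac{(-1)^{k}\sum_{l=1}^{k}\binom{m+1}{l}B_{l}S^{(1)}_{k}(l)}{(n+1)(n+2)\cdots(n+k)}$$ and, more generally, for every $a\in\mathbb{N}_{0}$, $$\sum_{k=1}^{n}k^{m}=\frac{1}{m+1}n^{m+1}+\zeta(-m)+\frac{1}{m+1}\sum_{k=1}^{a}(-1)^{k}\binom{m+1}{k}B_{k}n^{m-k+1}+\frac{n^{m-a+1}}{m+1}\sum_{k=1}^{\infty}\frac{(-1)^{k+a}\sum_{l=1}^{k}\binom{m+1}{l+a}B_{l+a}S^{(1)}_{k}(l)}{(n+1)(n+2)\cdots(n+k)}.$$ If $m_{1}:=\operatorname{Re}(m)\geq-1$ (still $m\ne -1$), one has the special case $$\sum_{k=1}^{n}k^{m}=\frac{1}{m+1}n^{m+1}+\zeta(-m)+\frac{1}{m+1}\sum_{k=1}^{\lfloor m_{1}+1\rfloor}(-1)^{k}\binom{m+1}{k}B_{k}n^{m-k+1}+(-1)^{\lfloor m_{1}+1\rfloor}\frac{n^{m-\lfloor m_{1}+1\rfloor+1}}{m+1}\sum_{k=1}^{\infty}(-1)^{k}\frac{\sum_{l=1}^{k}\binom{m+1}{l+\lfloor m_{1}+1\rfloor}B_{l+\lfloor m_{1}+1\rfloor}S^{(1)}_{k}(l)}{(n+1)(n+2)\cdots(n+k)}.$$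 For $m=-1$, for every $n\in\mathbb{N}$ and every $a\in\mathbb{N}_{0}$, $$\sum_{k=1}^{n}\frac{1}{k}=\log(n)+\gamma-\sum_{k=1}^{a}\frac{B_{k}}{kn^{k}}+\frac{1}{n^{a}}\sum_{k=1}^{\infty}\frac{(-1)^{k+1}\sum_{l=1}^{k}\frac{(-1)^{l}}{l+a}B_{l+a}S^{(1)}_{k}(l)}{(n+1)(n+2)\cdots(n+k)}.$$ In particular, for every $n\in\mathbb{N}$, $$\sum_{k=1}^{n}\frac{1}{k}=\log(n)+\gamma+\sum_{k=1}^{\infty}\frac{(-1)^{k+1}\sum_{l=1}^{k}\frac{(-1)^{l}}{l}B_{l}S_{k}^{(1)}(l)}{(n+1)(n+2)\cdots(n+k)},$$ where the terms of the series for $k=1,2,3,4$ are $\frac{1}{2(n+1)}$, $\frac{5}{12(n+1)(n+2)}$, $\frac{3}{4(n+1)(n+2)(n+3)}$, $\frac{251}{120(n+1)(n+2)(n+3)(n+4)}$, and $$\sum_{k=1}^{n}\frac{1}{k}=\log(n)+\gamma+\frac{1}{2n}+\sum_{k=1}^{\infty}\frac{(-1)^{k}\sum_{l=1}^{k}\frac{B_{l+1}}{l+1}S_{k}^{(1)}(l)}{n(n+1)(n+2)\cdots(n+k)},$$ where the terms of the series for $k=1,2,3,4$ are $-\frac{1}{12n(n+1)}$, $-\frac{1}{12n(n+1)(n+2)}$, $-\frac{19}{120n(n+1)(n+2)(n+3)}$, $-\frac{9}{20n(n+1)(n+2)(n+3)(n+4)}$.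
   Context: $\mathbb{N}=\{1,2,3,\ldots\}$, $\mathbb{N}_0=\mathbb{N}\cup\{0\}$; $\lfloor\cdot\rfloor$ is the floor; empty sums are $0$. $\zeta$ is the (meromorphically continued) Riemann zeta function and $\gamma$ is Euler's constant. For $t>0$ and $w\in\mathbb{C}$, $t^{w}=e^{w\log t}$ with real logarithm. Stirling numbers of the first kind (signed): for integers $k\ge l\ge 0$, $S^{(1)}_k(l)$ is defined by $z(z+1)\cdots(z+k-1)=(-1)^{k}\sum_{l=0}^{k}(-1)^{l}S_{k}^{(1)}(l)z^{l}$, and $S^{(1)}_k(l)=0$ for $l>k$. Binomial coefficients: $\binom{z}{s}=\frac{\Gamma(z+1)}{\Gamma(s+1)\Gamma(z-s+1)}$ for complex $z,s$; for $s=k\in\mathbb{N}_0$ this is $\binom{z}{k}=\frac{z(z-1)\cdots(z-k+1)}{k!}$, which is also the meaning when the gamma functions have poles. Bernoulli polynomials: $\frac{te^{xt}}{e^{t}-1}=\sum_{n=0}^{\infty}\frac{B_{n}(x)}{n!}t^{n}$ for $|t|<2\pi$; Bernoulli numbers: $B_n=B_n(0)$ (so $B_1=-\tfrac12$). *)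

theory Defs
  imports "HOL-Complex_Analysis.Complex_Analysis" "HOL-Combinatorics.Stirling"
begin

(* Signed Stirling numbers of the first kind, read off from the coefficients of
   z (z + 1) ... (z + k - 1) = (-1)^k * (\<Sum>l\<le>k. (-1)^l * stirling1 k l * z^l).
   The library constant stirling is the unsigned version. *)

definition stirling1 :: "nat \<Rightarrow> nat \<Rightarrow> int" where
  "stirling1 k l = (-1) ^ k * (-1) ^ l * coeff (pochhammer [:0, 1:] k) l"

lemma stirling1_conv_stirling: "stirling1 k l = (-1) ^ (k + l) * int (stirling k l)"
proof -
  have *: "[:0, 1::int:] ^ i = monom 1 i" for i
    by (simp add: monom_altdef)
  have "coeff (pochhammer [:0, 1::int:] k) l =
          (\<Sum>i\<le>k. coeff (of_nat (stirling k i) * [:0, 1:] ^ i) l)"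
    by (simp flip: stirling_pochhammer add: coeff_sum)
  also have "\<dots> = (\<Sum>i\<le>k. if i = l then int (stirling k i) else 0)"
    by (intro sum.cong refl) (auto simp: * of_nat_poly)
  also have "\<dots> = int (stirling k l)"
    by (auto simp: not_le)
  finally show ?thesis
    by (simp add: stirling1_def power_add)
qed

lemma pochhammer_conv_stirling1:
  fixes z :: "'a :: comm_ring_1"
  shows "pochhammer z k = (-1) ^ k * (\<Sum>l\<le>k. (-1) ^ l * of_int (stirling1 k l) * z ^ l)"
proof -
  have "(-1) ^ k * ((-1) ^ l * of_int (stirling1 k l) * z ^ l) = of_nat (stirling k l) * z ^ l" for l
    by (cases "even k"; cases "even l") (simp_all add: stirling1_conv_stirling)
  thus ?thesis
    by (simp add: sum_distrib_left flip: stirling_pochhammer)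
qed

lemma stirling1_eq_0: "k < l \<Longrightarrow> stirling1 k l = 0"
  by (simp add: stirling1_conv_stirling)


(* Bernoulli polynomials via the generating function t exp(x t) / (exp t - 1),
   so that bernoulli 1 = -1/2. *)

definition bernpoly :: "nat \<Rightarrow> 'a \<Rightarrow> 'a :: field_char_0" where
  "bernpoly n x = fact n * fps_nth (fps_X * fps_exp x / (fps_exp 1 - 1)) n"

definition bernoulli :: "nat \<Rightarrow> 'a :: field_char_0" where
  "bernoulli n = bernpoly n 0"

lemma subdegree_fps_exp_1_minus_1:
  "subdegree (fps_exp 1 - 1 :: 'a :: field_char_0 fps) = 1"
  by (rule subdegreeI) auto

lemma bernpoly_has_fps_expansion:
  fixes x :: complex
  shows "(\<lambda>t. if t = 0 then 1 else t * exp (x * t) / (exp t - 1))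
           has_fps_expansion Abs_fps (\<lambda>n. bernpoly n x / fact n)"
proof -
  have "fps_exp 1 - 1 \<noteq> (0 :: complex fps)"
    using subdegree_fps_exp_1_minus_1[where 'a = complex] by (metis subdegree_0 zero_neq_one)
  moreover have "subdegree (fps_X * fps_exp x) = 1"
    by (rule subdegreeI) auto
  ultimately have "(\<lambda>t. if t = 0 then 1 else t * exp (x * t) / (exp t - 1))
          has_fps_expansion (fps_X * fps_exp x / (fps_exp 1 - 1))"
    by (intro has_fps_expansion_divide fps_expansion_intros)
       (auto simp only: subdegree_fps_exp_1_minus_1, auto)
  also have "fps_X * fps_exp x / (fps_exp 1 - 1) = Abs_fps (\<lambda>n. bernpoly n x / fact n)"
    by (simp add: fps_eq_iff bernpoly_def)
  finally show ?thesis .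
qed


(* The Riemann zeta function, as the analytic continuation of its Dirichlet series to
   all complex numbers other than 1.  The continuation is unique there (zeta_eqI);
   the value at the pole 1 is unspecified. *)

definition zeta :: "complex \<Rightarrow> complex" where
  "zeta = (SOME f. f holomorphic_on (- {1}) \<and>
     (\<forall>s. Re s > 1 \<longrightarrow> f s = (\<Sum>n. 1 / of_nat (Suc n) powr s)))"

lemma zeta_eqI:
  assumes f: "f holomorphic_on (- {1})"
      and f_eq: "\<And>s. Re s > 1 \<Longrightarrow> f s = (\<Sum>n. 1 / of_nat (Suc n) powr s)"
      and "s \<noteq> 1"
  shows "zeta s = f s"
proof -
  have z: "zeta holomorphic_on (- {1}) \<and>
     (\<forall>s. Re s > 1 \<longrightarrow> zeta s = (\<Sum>n. 1 / of_nat (Suc n) powr s))"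
    unfolding zeta_def by (rule someI[of _ f]) (use f f_eq in auto)
  have "open {s. Re s > 1}"
    by (rule open_halfspace_Re_gt)
  show ?thesis
  proof (rule analytic_continuation_open[where s = "{s. Re s > 1}" and s' = "- {1}"
      and f = zeta and g = f])
    show "{s. Re s > 1} \<noteq> {}"
      by (auto intro: exI[of _ 2])
    show "connected (- {1 :: complex})"
      by (rule connected_punctured_universe) simp
  qed (use z f f_eq assms(3) \<open>open {s. Re s > 1}\<close> in auto)
qed

end

theory Submission
  imports Defs "HOL-Real_Asymp.Real_Asymp"
begin

text \<open>
  Let \<open>w = 1/2 + i y\<close> with \<open>y\<close> distributed according to the logistic density
  \<open>\<pi> / (2 cosh\<^sup>2 (\<pi> y))\<close>, and write \<open>E\<close> for the mean.  The residue theorem gives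
  \<open>E g (x + 1 + w) - E g (x + w) = g' (x + 1)\<close>.  Hence \<open>E w\<^sup>l = (-1)\<^sup>l B\<^sub>l\<close>, the power sums telescope to
  \<open>(E (n + w)\<^sup>M - E w\<^sup>M) / M\<close> with \<open>M = m + 1\<close>, and \<open>- E w\<^sup>M / M\<close> is the analytic continuation of
  \<open>\<zeta> (- m)\<close>; for \<open>m = -1\<close> the logarithm takes the place of the power.

  It remains to expand \<open>E (1 + w / n)\<^sup>M\<close>.  For fixed \<open>w\<close> the function \<open>v \<mapsto> (1 + w / v)\<^sup>M\<close> is analytic off the
  segment from \<open>0\<close> to \<open>- w\<close>, so it is a Cauchy integral over a rectangle around the segment.  Inserting
  Waring's expansion of \<open>1 / (x - v)\<close> into a factorial series produces Stirling numbers times Laurent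
  coefficients at infinity, with an error of order \<open>exp (\<pi> |y| / 2) / sqrt K\<close> up to powers of \<open>1 + |y|\<close>.
  The logistic density decays like \<open>exp (- 2 \<pi> |y|)\<close>, so the mean may be taken term by term.
\<close>

subsection \<open>The logistic mean on the line \<open>Re w = 1/2\<close>\<close>

text \<open>Averaging the binomial series of \<open>(1 + w / n) powr M\<close> directly fails:
  \<open>w\<close> is unbounded while \<open>n\<close> is fixed, and the resulting series in powers
  of \<open>1 / n\<close> diverges in general. A factorial series only needs the singularities in
  \<open>v\<close> to lie in a half plane to the left of \<open>n\<close>, and they do for every
  \<open>y\<close>, because the segment stays in \<open>-1/2 <= Re v <= 0\<close>. The contour has
  to hug the segment: a circle around it would reach beyond \<open>Re v = n\<close> for large
  \<open>|y|\<close>, where Waring's series diverges. A rectangle of fixed width avoids this, and on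
  it \<open>|Im v| <= |y| + 1\<close>. The Waring remainder is a product of factors
  \<open>|v + i| / (n + i)\<close> for \<open>i >= 1\<close>; Euler's product bounds its square by a
  hyperbolic sine of \<open>pi (|y| + 1)\<close>, and the square root accounts for the rate
  \<open>exp (pi |y| / 2)\<close>.\<close>

definition logistic_density :: "real \<Rightarrow> real" where
  "logistic_density y = pi / (2 * cosh (pi * y) ^ 2)"

definition bern_line :: "real \<Rightarrow> complex" where
  "bern_line y = Complex (1 / 2) y"

definition bern_mean :: "(complex \<Rightarrow> complex) \<Rightarrow> complex" where
  "bern_mean g = (\<integral>y. of_real (logistic_density y) * g (bern_line y) \<partial>lborel)"

text \<open>
  Polynomial growth on the slit plane, near \<open>0\<close> as well as near \<open>\<infinity>\<close>.  The explicit constants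
  make the error bounds below uniform in the exponent of a power function.
\<close>

definition slit_bounded :: "real \<Rightarrow> nat \<Rightarrow> (complex \<Rightarrow> complex) \<Rightarrow> bool" where
  "slit_bounded C N h \<longleftrightarrow> h holomorphic_on (- \<real>\<^sub>\<le>\<^sub>0) \<and>
     (\<forall>v R. v \<notin> \<real>\<^sub>\<le>\<^sub>0 \<longrightarrow> 1 \<le> R \<longrightarrow> norm v \<le> R \<longrightarrow> 1 / R \<le> norm v \<longrightarrow> norm (h v) \<le> C * R ^ N)"

section \<open>Integrability against the logistic density\<close>

lemma bern_line_simps [simp]: "Re (bern_line y) = 1 / 2" "Im (bern_line y) = y"
  by (simp_all add: bern_line_def)

lemma continuous_on_bern_line [continuous_intros]: "continuous_on A bern_line"
proof -
  have "continuous_on A (\<lambda>y. 1 / 2 + \<i> * complex_of_real y)"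
    by (intro continuous_intros)
  also have "(\<lambda>y. 1 / 2 + \<i> * complex_of_real y) = bern_line"
    by (auto simp: complex_eq_iff)
  finally show ?thesis .
qed

lemma logistic_density_nonneg: "0 \<le> logistic_density y"
  by (simp add: logistic_density_def)

lemma continuous_on_logistic_density [continuous_intros]: "continuous_on A logistic_density"
  unfolding logistic_density_def by (intro continuous_intros) auto

lemma logistic_density_le: "logistic_density y \<le> 2 * pi * exp (- (2 * pi * \<bar>y\<bar>))"
proof -
  have "exp \<bar>pi * y\<bar> \<le> 2 * cosh (pi * y)"
    by (cases "y \<ge> 0") (auto simp: cosh_def abs_if mult_nonneg_nonneg)
  hence "(exp \<bar>pi * y\<bar>) ^ 2 \<le> (2 * cosh (pi * y)) ^ 2"
    by (intro power_mono) auto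
  also have "(exp \<bar>pi * y\<bar>) ^ 2 = exp (2 * pi * \<bar>y\<bar>)"
    by (simp add: power2_eq_square abs_mult flip: exp_add)
  finally have "exp (2 * pi * \<bar>y\<bar>) \<le> 4 * cosh (pi * y) ^ 2"
    by (simp add: power_mult_distrib)
  hence "2 * pi / (4 * cosh (pi * y) ^ 2) \<le> 2 * pi / exp (2 * pi * \<bar>y\<bar>)"
    by (intro divide_left_mono) auto
  thus ?thesis
    by (simp add: logistic_density_def exp_minus field_simps)
qed

lemma power_le_fact_exp:
  fixes x :: real
  assumes "0 \<le> x"
  shows "x ^ N \<le> fact N * exp x"
proof -
  have "(\<Sum>n\<in>{N}. x ^ n /\<^sub>R fact n) \<le> (\<Sum>n. x ^ n /\<^sub>R fact n)"
    using assms by (intro sum_le_suminf summable_exp_generic) (auto intro!: divide_nonneg_nonneg)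
  thus ?thesis by (simp add: exp_def field_simps)
qed

text \<open>Weighs the density against the growth of the factorial series remainder. The polynomial
  is absorbed at the price of \<open>exp |y|\<close>, and since
  \<open>2 pi - pi / 2 = 3 pi / 2 > 2\<close> a factor \<open>exp (- |y|)\<close> is left
  over.\<close>

lemma logistic_density_times_le:
  "logistic_density y * ((1 + \<bar>y\<bar>) ^ N * exp (pi * \<bar>y\<bar> / 2))
     \<le> 2 * pi * fact N * exp 1 * exp (- \<bar>y\<bar>)"
proof -
  have "(1 + \<bar>y\<bar>) ^ N \<le> fact N * exp (1 + \<bar>y\<bar>)"
    by (rule power_le_fact_exp) auto
  hence "logistic_density y * ((1 + \<bar>y\<bar>) ^ N * exp (pi * \<bar>y\<bar> / 2))
      \<le> (2 * pi * exp (- (2 * pi * \<bar>y\<bar>))) * ((fact N * exp (1 + \<bar>y\<bar>)) * exp (pi * \<bar>y\<bar> / 2))"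
    by (intro mult_mono logistic_density_le) (auto simp: logistic_density_nonneg)
  also have "\<dots> = 2 * pi * fact N * (exp 1 * exp (- (2 * pi * \<bar>y\<bar>) + \<bar>y\<bar> + pi * \<bar>y\<bar> / 2))"
    by (simp only: exp_add mult_ac)
  also have "\<dots> \<le> 2 * pi * fact N * (exp 1 * exp (- \<bar>y\<bar>))"
  proof -
    have "2 * \<bar>y\<bar> \<le> 3 * pi / 2 * \<bar>y\<bar>"
      using pi_gt3 by (intro mult_right_mono) auto
    thus ?thesis by (intro mult_left_mono) auto
  qed
  finally show ?thesis by (simp add: mult_ac)
qed

lemma integrable_exp_minus_abs: "integrable lborel (\<lambda>y::real. exp (- \<bar>y\<bar>))"
proof -
  have 1: "set_integrable lborel {0..} (\<lambda>y::real. exp (- y))"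
  proof -
    have "(\<lambda>y::real. exp (- y)) absolutely_integrable_on {0..}"
      using integrable_on_exp_minus_to_infinity[of 1 0]
      by (intro nonnegative_absolutely_integrable_1) auto
    thus ?thesis unfolding set_integrable_def
      by (subst (asm) integrable_completion) auto
  qed
  have 2: "integrable lborel (\<lambda>y::real. indicator {0..} (- y) *\<^sub>R exp (- (- y)))"
    using lborel_integrable_real_affine[OF 1[unfolded set_integrable_def], of "-1" 0] by simp
  have "integrable lborel (\<lambda>y::real. indicator {0..} y *\<^sub>R exp (- y) + indicator {0..} (- y) *\<^sub>R exp (- (- y)))"
    by (rule Bochner_Integration.integrable_add[OF 1[unfolded set_integrable_def] 2])
  thus ?thesis
    by (rule Bochner_Integration.integrable_bound) (auto simp: indicator_def)
qed

lemma integrable_logistic: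
  fixes G :: "real \<Rightarrow> complex"
  assumes "continuous_on UNIV G" "\<And>y. norm (G y) \<le> B * (1 + \<bar>y\<bar>) ^ N"
  shows "integrable lborel (\<lambda>y. of_real (logistic_density y) * G y)"
proof (rule Bochner_Integration.integrable_bound[where f = "\<lambda>y. B * (2 * pi * fact N * exp 1) * exp (- \<bar>y\<bar>)"])
  show "integrable lborel (\<lambda>y::real. B * (2 * pi * fact N * exp 1) * exp (- \<bar>y\<bar>))"
    by (intro integrable_mult_right integrable_exp_minus_abs)
  have "continuous_on UNIV (\<lambda>y. of_real (logistic_density y) * G y)"
    by (intro continuous_intros assms)
  thus "(\<lambda>y. of_real (logistic_density y) * G y) \<in> borel_measurable lborel"
    by (simp add: borel_measurable_continuous_onI)
  have B: "0 \<le> B" using assms(2)[of 0] norm_ge_zero[of "G 0"] by (simp del: norm_ge_zero)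
  have "norm (of_real (logistic_density y) * G y) \<le> norm (B * (2 * pi * fact N * exp 1) * exp (- \<bar>y\<bar>))" for y
  proof -
    have "norm (of_real (logistic_density y) * G y) = logistic_density y * norm (G y)"
      by (simp add: norm_mult logistic_density_nonneg)
    also have "\<dots> \<le> logistic_density y * (B * (1 + \<bar>y\<bar>) ^ N)"
      by (intro mult_left_mono assms logistic_density_nonneg)
    also have "\<dots> = B * (logistic_density y * ((1 + \<bar>y\<bar>) ^ N * 1))" by simp
    also have "\<dots> \<le> B * (logistic_density y * ((1 + \<bar>y\<bar>) ^ N * exp (pi * \<bar>y\<bar> / 2)))"
      using B by (intro mult_left_mono) (auto simp: logistic_density_nonneg)
    also have "\<dots> \<le> B * (2 * pi * fact N * exp 1 * exp (- \<bar>y\<bar>))"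
      using B by (intro mult_left_mono logistic_density_times_le)
    finally show ?thesis using B by (simp add: abs_mult)
  qed
  thus "AE y in lborel. norm (of_real (logistic_density y) * G y) \<le> norm (B * (2 * pi * fact N * exp 1) * exp (- \<bar>y\<bar>))"
    by simp
qed

lemma slit_boundedD:
  assumes "slit_bounded C N h" "v \<notin> \<real>\<^sub>\<le>\<^sub>0" "1 \<le> R" "norm v \<le> R" "1 / R \<le> norm v"
  shows "norm (h v) \<le> C * R ^ N"
  using assms unfolding slit_bounded_def by blast

lemma slit_bounded_nonneg: "slit_bounded C N h \<Longrightarrow> 0 \<le> C"
proof -
  assume h: "slit_bounded C N h"
  have "norm (h 1) \<le> C * 1 ^ N"
    by (rule slit_boundedD[OF h]) (auto simp: complex_nonpos_Reals_iff)
  thus ?thesis using norm_ge_zero[of "h 1"] by (simp del: norm_ge_zero)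
qed

lemma norm_bern_line_le: "norm (bern_line y) \<le> 1 / 2 + \<bar>y\<bar>"
  using cmod_le[of "bern_line y"] by simp

text \<open>\<open>slit_bounded\<close> controls \<open>h\<close> only where one \<open>R\<close>
  dominates both \<open>norm z\<close> and its reciprocal. The summand 2 in the base settles the
  reciprocal, because \<open>norm z\<close> is at least \<open>1/2\<close> here.\<close>

lemma slit_bounded_vertical:
  assumes h: "slit_bounded C N h" and z: "1 / 2 \<le> Re z" "Re z \<le> b"
  shows "norm (h z) \<le> C * (b + 2 + \<bar>Im z\<bar>) ^ N"
proof (rule slit_boundedD[OF h])
  show "z \<notin> \<real>\<^sub>\<le>\<^sub>0" using z by (auto simp: complex_nonpos_Reals_iff)
  show "1 \<le> b + 2 + \<bar>Im z\<bar>" using z by simp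
  show "norm z \<le> b + 2 + \<bar>Im z\<bar>" using cmod_le[of z] z by simp
  have "1 / (b + 2 + \<bar>Im z\<bar>) \<le> 1 / 2"
    using z by (intro divide_left_mono) auto
  also have "\<dots> \<le> norm z" using z complex_Re_le_cmod[of z] by simp
  finally show "1 / (b + 2 + \<bar>Im z\<bar>) \<le> norm z" .
qed

lemma slit_bounded_bern_line:
  assumes h: "slit_bounded C N h" and "0 \<le> x"
  shows "continuous_on UNIV (\<lambda>y. h (of_real x + bern_line y))"
    and "norm (h (of_real x + bern_line y)) \<le> C * (x + 3) ^ N * (1 + \<bar>y\<bar>) ^ N"
    and "integrable lborel (\<lambda>y. of_real (logistic_density y) * h (of_real x + bern_line y))"
proof -
  have "continuous_on (- \<real>\<^sub>\<le>\<^sub>0) h"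
    using h by (auto simp: slit_bounded_def intro: holomorphic_on_imp_continuous_on)
  thus 1: "continuous_on UNIV (\<lambda>y. h (of_real x + bern_line y))"
    by (rule continuous_on_compose2)
       (use assms in \<open>auto intro!: continuous_intros simp: complex_nonpos_Reals_iff\<close>)
  have 2: "norm (h (of_real x + bern_line y)) \<le> C * (x + 3) ^ N * (1 + \<bar>y\<bar>) ^ N" for y
  proof -
    have "norm (h (of_real x + bern_line y)) \<le> C * (x + 1 / 2 + 2 + \<bar>Im (of_real x + bern_line y)\<bar>) ^ N"
      by (rule slit_bounded_vertical[OF h]) (use assms in auto)
    also have "\<dots> \<le> C * ((x + 3) * (1 + \<bar>y\<bar>)) ^ N"
      using assms slit_bounded_nonneg[OF h]
      by (intro mult_left_mono power_mono) (auto simp: algebra_simps)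
    finally show ?thesis by (simp add: power_mult_distrib mult_ac)
  qed
  thus "norm (h (of_real x + bern_line y)) \<le> C * (x + 3) ^ N * (1 + \<bar>y\<bar>) ^ N" .
  show "integrable lborel (\<lambda>y. of_real (logistic_density y) * h (of_real x + bern_line y))"
    by (rule integrable_logistic[OF 1 2])
qed

section \<open>The difference equation by residues\<close>

lemma has_field_derivative_zero_of_even:
  fixes s :: "complex \<Rightarrow> complex"
  assumes s: "s field_differentiable (at c)" and even: "\<And>z. s (c + z) = s (c - z)"
  shows "deriv s c = 0"
proof -
  have D: "(s has_field_derivative deriv s c) (at c)"
    using s by (simp add: DERIV_deriv_iff_field_differentiable)
  have "((\<lambda>w. s (2 * c - w)) has_field_derivative (deriv s c * (-1))) (at c)"
    by (rule DERIV_chain2[where g = "\<lambda>w. 2 * c - w"]) (use D in \<open>auto intro!: derivative_eq_intros\<close>)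
  moreover have "s (2 * c - w) = s w" for w
    using even[of "c - w"] by (simp add: algebra_simps)
  ultimately have "(s has_field_derivative (deriv s c * (-1))) (at c)"
    by simp
  hence "deriv s c = deriv s c * (-1)"
    by (rule DERIV_unique[OF D])
  thus ?thesis by simp
qed

lemma contour_integral_rectpath:
  assumes "f contour_integrable_on (rectpath a1 a3)"
  shows "contour_integral (rectpath a1 a3) f =
     contour_integral (linepath a1 (Complex (Re a3) (Im a1))) f
     + contour_integral (linepath (Complex (Re a3) (Im a1)) a3) f
     + contour_integral (linepath a3 (Complex (Re a1) (Im a3))) f
     + contour_integral (linepath (Complex (Re a1) (Im a3)) a1) f"
    "f contour_integrable_on (linepath a1 (Complex (Re a3) (Im a1)))"
    "f contour_integrable_on (linepath (Complex (Re a3) (Im a1)) a3)"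
    "f contour_integrable_on (linepath a3 (Complex (Re a1) (Im a3)))"
    "f contour_integrable_on (linepath (Complex (Re a1) (Im a3)) a1)"
  using assms unfolding rectpath_def Let_def by simp_all

lemma sin_pi_eq_0_strip:
  assumes "sin (of_real pi * (w - of_real c)) = 0" "\<bar>Re w - c\<bar> < 1"
  shows "w = of_real c"
proof -
  obtain n :: int where n: "of_real pi * (w - of_real c) = of_real (of_int n * pi)"
    using assms(1) by (auto simp: sin_eq_0)
  hence "w - of_real c = of_int n" by simp
  hence "Re w - c = of_int n" "Im w = 0"
    by (auto simp: complex_eq_iff)
  moreover have "n = 0" using assms(2) calculation by auto
  ultimately show ?thesis by (auto simp: complex_eq_iff)
qed

text \<open>A consequence of \<open>|sin z|^2 = sin^2 (Re z) + sinh^2 (Im z)\<close>. It makes the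
  horizontal sides of the residue rectangle negligible.\<close>

lemma norm_sin_ge_sinh: "sinh \<bar>Im z\<bar> \<le> norm (sin z)"
proof -
  have 1: "norm (sin z) ^ 2 = (exp (2 * Im z) + inverse (exp (2 * Im z)) - 2 * cos (2 * Re z)) / 4"
    by (rule norm_sin_squared)
  have 2: "sinh \<bar>Im z\<bar> ^ 2 = (exp (2 * Im z) + inverse (exp (2 * Im z)) - 2) / 4"
    by (simp add: sinh_def abs_if power2_eq_square field_simps exp_minus flip: exp_add)
  have "sinh \<bar>Im z\<bar> ^ 2 \<le> norm (sin z) ^ 2"
    unfolding 1 2 by (intro divide_right_mono diff_mono) auto
  thus ?thesis by (rule power2_le_imp_le) auto
qed

text \<open>
  On the lines \<open>Re w = c \<plusminus> 1/2\<close> the squared sine is \<open>cosh\<^sup>2\<close>, so the two logistic means are the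
  vertical sides of a rectangle around the double pole of \<open>g w / sin\<^sup>2 (\<pi> (w - c))\<close> at \<open>c\<close>.
\<close>

lemma truncated_shift:
  assumes g: "slit_bounded C N g" and c: "1 \<le> c" and T: "0 < T"
  defines "F \<equiv> (\<lambda>x. integral {-T..T} (\<lambda>y. of_real (logistic_density y) * g (of_real x + bern_line y)))"
  shows "norm (F c - F (c - 1) - deriv g (of_real c)) \<le> pi * (C * (c + 3 + T) ^ N / sinh (pi * T) ^ 2)"
proof -
  define z0 where "z0 = complex_of_real c"
  define sn where "sn = (\<lambda>w. sin (of_real pi * (w - z0)))"
  \<comment> \<open>This is \<open>sin (pi (w - z0)) / (w - z0)\<close> with its removable
    singularity filled in. It has no zero in the strip \<open>S\<close>, so \<open>g / s^2\<close>
    is holomorphic there and the double pole sits entirely in the factor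
    \<open>(w - z0)^2\<close>.\<close>
  define s where "s = (\<lambda>w. if w = z0 then deriv sn z0 else (sn w - sn z0) / (w - z0))"
  define S where "S = {w. c - 1 < Re w} \<inter> {w. Re w < c + 1}"
  have S: "open S" "convex S"
    unfolding S_def by (intro open_Int convex_Int open_halfspace_Re_gt open_halfspace_Re_lt
        convex_halfspace_Re_gt convex_halfspace_Re_lt)+
  have sn_holo: "sn holomorphic_on UNIV"
    unfolding sn_def by (intro holomorphic_intros)
  have s_holo: "s holomorphic_on UNIV"
    unfolding s_def by (intro pole_lemma_open sn_holo) auto
  have sn_z0: "sn z0 = 0" by (simp add: sn_def)
  have "(sn has_field_derivative of_real pi) (at z0)"
    unfolding sn_def by (auto intro!: derivative_eq_intros)
  hence deriv_sn: "deriv sn z0 = of_real pi" by (rule DERIV_imp_deriv)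
  have s_z0: "s z0 = of_real pi" by (simp add: s_def deriv_sn)
  have s_eq: "s w = sn w / (w - z0)" if "w \<noteq> z0" for w
    using that by (simp add: s_def sn_z0)
  have s_nz: "s w \<noteq> 0" if "w \<in> S" for w
  proof (cases "w = z0")
    case False
    have "\<bar>Re w - c\<bar> < 1" using that by (simp add: S_def abs_less_iff)
    hence "sn w \<noteq> 0" using False sin_pi_eq_0_strip[of w c] by (auto simp: sn_def z0_def)
    thus ?thesis using False by (simp add: s_eq)
  qed (auto simp: s_z0)
  \<comment> \<open>The sine is odd, so \<open>s\<close> is even about \<open>z0\<close>. Hence the
    derivative of \<open>g / s^2\<close> at \<open>z0\<close>, which is the residue, contains no
    multiple of \<open>g z0\<close>.\<close>
  have deriv_s: "deriv s z0 = 0"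
  proof (rule has_field_derivative_zero_of_even)
    show "s field_differentiable (at z0)"
      using s_holo by (simp add: holomorphic_on_def)
    show "s (z0 + z) = s (z0 - z)" for z
      by (cases "z = 0") (auto simp: s_eq sn_def field_simps)
  qed
  have g_holo: "g holomorphic_on S"
    using g by (rule_tac holomorphic_on_subset) (use c in \<open>auto simp: slit_bounded_def S_def complex_nonpos_Reals_iff\<close>)
  define G where "G = (\<lambda>w. g w / s w ^ 2)"
  have G_holo: "G holomorphic_on S"
    unfolding G_def using s_nz
    by (intro holomorphic_intros g_holo holomorphic_on_subset[OF s_holo]) auto
  have z0_S: "z0 \<in> S" by (simp add: S_def z0_def)
  have "(g has_field_derivative deriv g z0) (at z0)" "(s has_field_derivative 0) (at z0)"
    using holomorphic_derivI[OF g_holo S(1) z0_S] holomorphic_derivI[OF s_holo, of z0] deriv_s by auto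
  hence "(G has_field_derivative deriv g z0 / of_real pi ^ 2) (at z0)"
    unfolding G_def by (auto intro!: derivative_eq_intros simp: s_z0 power2_eq_square field_simps)
  hence deriv_G: "deriv G z0 = deriv g z0 / of_real pi ^ 2" by (rule DERIV_imp_deriv)
  define q where "q = (\<lambda>w. G w / (w - z0) ^ Suc 1)"
  have q_eq: "q w = g w / sn w ^ 2" if "w \<noteq> z0" for w
    using that by (simp add: q_def G_def s_eq power2_eq_square divide_simps)
  define a1 a3 where "a1 = Complex (c - 1 / 2) (-T)" and "a3 = Complex (c + 1 / 2) T"
  note [simp] = a1_def a3_def
  have img: "path_image (rectpath a1 a3) \<subseteq> S - {z0}"
    using T by (auto simp: path_image_rectpath S_def z0_def)
  have int: "contour_integral (rectpath a1 a3) q = 2 * pi * \<i> * (\<Sum>p\<in>{z0}. winding_number (rectpath a1 a3) p * residue q p)"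
  proof (rule Residue_theorem)
    show "q holomorphic_on S - {z0}"
      unfolding q_def by (intro holomorphic_intros holomorphic_on_subset[OF G_holo]) auto
    show "\<forall>z. z \<notin> S \<longrightarrow> winding_number (rectpath a1 a3) z = 0"
    proof (intro allI impI winding_number_rectpath_outside)
      show "z \<notin> cbox a1 a3" if "z \<notin> S" for z
        using that by (auto simp: S_def in_cbox_complex_iff)
    qed (use T in auto)
  qed (use S img in \<open>auto intro: convex_connected\<close>)
  also have "(\<Sum>p\<in>{z0}. winding_number (rectpath a1 a3) p * residue q p) = winding_number (rectpath a1 a3) z0 * residue q z0"
    by simp
  also have "winding_number (rectpath a1 a3) z0 = 1"
    by (rule winding_number_rectpath) (use T in \<open>auto simp: in_box_complex_iff z0_def\<close>)
  also have "residue q z0 = deriv g z0 / of_real pi ^ 2"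
    unfolding q_def using residue_holomorphic_over_power[OF S(1) z0_S G_holo, of 1] deriv_G by simp
  finally have I1: "contour_integral (rectpath a1 a3) q = 2 * \<i> / of_real pi * deriv g z0"
    by (simp add: power2_eq_square field_simps)
  have "q contour_integrable_on rectpath a1 a3"
    by (rule contour_integrable_holomorphic_simple[of _ "S - {z0}"])
       (use S img in \<open>auto simp: q_def intro!: holomorphic_intros holomorphic_on_subset[OF G_holo]\<close>)
  note I2 = contour_integral_rectpath[OF this, simplified]
  have sn_right: "sn (Complex (c + 1 / 2) y) = of_real (cosh (pi * y))" for y
  proof -
    have "of_real pi * (Complex (c + 1 / 2) y - z0) = of_real pi / 2 + of_real pi * (\<i> * of_real y)"
      by (simp add: complex_eq_iff z0_def)
    hence "sn (Complex (c + 1 / 2) y) = sin (of_real pi / 2 - (- (\<i> * of_real (pi * y))))"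
      by (simp add: sn_def mult_ac)
    also have "\<dots> = cosh (of_real (pi * y))"
      by (simp only: cos_sin_eq [symmetric] cos_minus cosh_conv_cos)
    also have "\<dots> = of_real (cosh (pi * y))"
      by (simp add: cosh_field_def flip: exp_of_real)
    finally show ?thesis .
  qed
  have sn_left: "sn (Complex (c - 1 / 2) y) = - of_real (cosh (pi * y))" for y
  proof -
    have "of_real pi * (Complex (c - 1 / 2) y - z0) = of_real pi * (Complex (c + 1 / 2) y - z0) - of_real pi"
      by (simp add: complex_eq_iff z0_def algebra_simps)
    hence "sn (Complex (c - 1 / 2) y) = - sn (Complex (c + 1 / 2) y)"
      unfolding sn_def by (simp add: sin_diff)
    thus ?thesis by (simp add: sn_right)
  qed
  \<comment> \<open>The factor \<open>2 / pi\<close> cancels the constant \<open>pi / 2\<close> of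
    \<open>logistic_density\<close>, leaving \<open>g / cosh^2\<close>.\<close>
  have q_right: "q (Complex (c + 1 / 2) y) = of_real (2 / pi) * (of_real (logistic_density y) * g (of_real c + bern_line y))" for y
  proof -
    have eq: "Complex (c + 1 / 2) y = of_real c + bern_line y" by (simp add: complex_eq_iff)
    have "q (Complex (c + 1 / 2) y) = g (Complex (c + 1 / 2) y) / sn (Complex (c + 1 / 2) y) ^ 2"
      by (rule q_eq) (simp add: complex_eq_iff z0_def)
    also have "\<dots> = of_real (2 / pi) * (of_real (logistic_density y) * g (Complex (c + 1 / 2) y))"
      by (simp only: sn_right) (simp add: logistic_density_def)
    finally show ?thesis by (simp only: eq)
  qed
  have q_left: "q (Complex (c - 1 / 2) y) = of_real (2 / pi) * (of_real (logistic_density y) * g (of_real (c - 1) + bern_line y))" for y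
  proof -
    have eq: "Complex (c - 1 / 2) y = of_real (c - 1) + bern_line y" by (simp add: complex_eq_iff)
    have "q (Complex (c - 1 / 2) y) = g (Complex (c - 1 / 2) y) / sn (Complex (c - 1 / 2) y) ^ 2"
      by (rule q_eq) (simp add: complex_eq_iff z0_def)
    also have "\<dots> = of_real (2 / pi) * (of_real (logistic_density y) * g (Complex (c - 1 / 2) y))"
      by (simp only: sn_left) (simp add: logistic_density_def)
    finally show ?thesis by (simp only: eq)
  qed
  define B where "B = C * (c + 3 + T) ^ N / sinh (pi * T) ^ 2"
  have B: "0 \<le> B" using slit_bounded_nonneg[OF g] c T by (simp add: B_def)
  have q_bound: "norm (q w) \<le> B" if w: "c - 1 / 2 \<le> Re w" "Re w \<le> c + 1 / 2" "\<bar>Im w\<bar> = T" for w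
  proof -
    have "norm (g w) \<le> C * (c + 1 / 2 + 2 + \<bar>Im w\<bar>) ^ N"
      by (rule slit_bounded_vertical[OF g]) (use w c in auto)
    also have "\<dots> \<le> C * (c + 3 + T) ^ N"
      using w c T slit_bounded_nonneg[OF g] by (intro mult_left_mono power_mono) auto
    finally have 1: "norm (g w) \<le> C * (c + 3 + T) ^ N" .
    have "sinh (pi * T) \<le> norm (sn w)"
      using norm_sin_ge_sinh[of "of_real pi * (w - z0)"] w by (simp add: sn_def z0_def abs_mult)
    hence 2: "sinh (pi * T) ^ 2 \<le> norm (sn w) ^ 2"
      using T by (intro power_mono) auto
    have "w \<noteq> z0" using w T by (auto simp: z0_def)
    hence "norm (q w) = norm (g w) / norm (sn w) ^ 2"
      by (simp add: q_eq norm_divide norm_power)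
    also have "\<dots> \<le> B"
      unfolding B_def using T 1 2 order_trans[OF norm_ge_zero 1] by (intro frac_le) auto
    finally show ?thesis .
  qed
  define h1 h3 where
    "h1 = contour_integral (linepath (Complex (c - 1 / 2) (-T)) (Complex (c + 1 / 2) (-T))) q"
    and "h3 = contour_integral (linepath (Complex (c + 1 / 2) T) (Complex (c - 1 / 2) T)) q"
  have "norm h1 \<le> B * norm (Complex (c + 1 / 2) (-T) - Complex (c - 1 / 2) (-T))"
    unfolding h1_def using I2 B T
    by (intro contour_integral_bound_linepath q_bound)
       (auto simp: closed_segment_same_Im closed_segment_eq_real_ivl)
  also have "Complex (c + 1 / 2) (-T) - Complex (c - 1 / 2) (-T) = 1"
    by (simp add: complex_eq_iff)
  finally have h1: "norm h1 \<le> B" by simp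
  have "norm h3 \<le> B * norm (Complex (c - 1 / 2) T - Complex (c + 1 / 2) T)"
    unfolding h3_def using I2 B T
    by (intro contour_integral_bound_linepath q_bound)
       (auto simp: closed_segment_same_Im closed_segment_eq_real_ivl)
  also have "Complex (c - 1 / 2) T - Complex (c + 1 / 2) T = - 1"
    by (simp add: complex_eq_iff)
  finally have h3: "norm h3 \<le> B" by simp
  have right: "contour_integral (linepath (Complex (c + 1 / 2) (-T)) (Complex (c + 1 / 2) T)) q
      = \<i> * (of_real (2 / pi) * F c)"
    using T by (subst contour_integral_linepath_same_Re[where c = "c + 1 / 2" and a = "-T" and b = T])
      (simp_all add: q_right F_def)
  have left: "contour_integral (linepath (Complex (c - 1 / 2) T) (Complex (c - 1 / 2) (-T))) q
      = - (\<i> * (of_real (2 / pi) * F (c - 1)))"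
  proof -
    have "contour_integral (reversepath (linepath (Complex (c - 1 / 2) (-T)) (Complex (c - 1 / 2) T))) q
        = - contour_integral (linepath (Complex (c - 1 / 2) (-T)) (Complex (c - 1 / 2) T)) q"
      by (rule contour_integral_reversepath) simp
    also have "contour_integral (linepath (Complex (c - 1 / 2) (-T)) (Complex (c - 1 / 2) T)) q
        = \<i> * (of_real (2 / pi) * F (c - 1))"
      using T by (subst contour_integral_linepath_same_Re[where c = "c - 1 / 2" and a = "-T" and b = T])
        (simp_all add: q_left F_def)
    finally show ?thesis by simp
  qed
  have "2 * \<i> / of_real pi * deriv g z0 = h1 + \<i> * (of_real (2 / pi) * F c) + h3 - \<i> * (of_real (2 / pi) * F (c - 1))"
    using I2(1) I1 right left unfolding h1_def h3_def by simp
  hence "h1 + h3 = 2 * \<i> / of_real pi * (deriv g z0 - F c + F (c - 1))"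
    by (simp add: algebra_simps diff_divide_distrib add_divide_distrib)
  hence "F c - F (c - 1) - deriv g z0 = \<i> * of_real (pi / 2) * (h1 + h3)"
    by simp
  hence "norm (F c - F (c - 1) - deriv g z0) = pi / 2 * norm (h1 + h3)"
    by (simp only: norm_mult) simp
  also have "\<dots> \<le> pi / 2 * (B + B)"
    by (intro mult_left_mono order_trans[OF norm_triangle_ineq] add_mono h1 h3) auto
  finally show ?thesis by (simp add: B_def z0_def)
qed

text \<open>The height \<open>T\<close> of the rectangle tends to infinity: the truncated means
  converge by dominated convergence, and the horizontal sides contribute at most a polynomial in
  \<open>T\<close> over \<open>sinh^2 (pi T)\<close>.\<close>

theorem bern_mean_shift:
  assumes g: "slit_bounded C N g" and c: "1 \<le> c"
  shows "bern_mean (\<lambda>w. g (of_real c + w)) - bern_mean (\<lambda>w. g (of_real (c - 1) + w)) = deriv g (of_real c)"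
proof -
  define f where "f = (\<lambda>x y. of_real (logistic_density y) * g (of_real x + bern_line y))"
  define F where "F = (\<lambda>x T. integral {-T..T} (f x))"
  have F_lim: "(F x \<longlongrightarrow> bern_mean (\<lambda>w. g (of_real x + w))) at_top" if "0 \<le> x" for x
  proof -
    have int: "integrable lborel (f x)"
      unfolding f_def by (rule slit_bounded_bern_line[OF g that])
    have "((\<lambda>T. set_lebesgue_integral lborel {-T..T} (f x)) \<longlongrightarrow> set_lebesgue_integral lborel UNIV (f x)) at_top"
      unfolding set_lebesgue_integral_def
    proof (rule integral_dominated_convergence_at_top[where w = "\<lambda>y. norm (f x y)"])
      show "\<forall>\<^sub>F T in at_top. AE y in lborel. norm (indicat_real {-T..T} y *\<^sub>R f x y) \<le> norm (f x y)"
        by (auto simp: indicator_def)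
      show "AE y in lborel. ((\<lambda>T. indicat_real {-T..T} y *\<^sub>R f x y) \<longlongrightarrow> indicat_real UNIV y *\<^sub>R f x y) at_top"
      proof (intro AE_I2 tendsto_eventually)
        fix y :: real
        show "\<forall>\<^sub>F T in at_top. indicat_real {-T..T} y *\<^sub>R f x y = indicat_real UNIV y *\<^sub>R f x y"
          using eventually_ge_at_top[of "\<bar>y\<bar>"] by eventually_elim (auto simp: indicator_def)
      qed
      show "(\<lambda>y. indicat_real UNIV y *\<^sub>R f x y) \<in> borel_measurable lborel"
        using int by simp
      show "(\<lambda>y. indicat_real {-T..T} y *\<^sub>R f x y) \<in> borel_measurable lborel" for T
        using int by (intro borel_measurable_scaleR) auto
      show "integrable lborel (\<lambda>y. norm (f x y))"
        using int by simp
    qed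
    also have "(\<lambda>T. set_lebesgue_integral lborel {-T..T} (f x)) = F x"
    proof
      fix T
      have "set_integrable lborel {-T..T} (f x)"
        using int unfolding set_integrable_def by (intro integrable_mult_indicator) auto
      thus "set_lebesgue_integral lborel {-T..T} (f x) = F x T"
        unfolding F_def by (rule set_borel_integral_eq_integral(2))
    qed
    finally show ?thesis
      by (simp add: set_lebesgue_integral_def bern_mean_def f_def)
  qed
  have "((\<lambda>T. pi * (C * (c + 3 + T) ^ N / sinh (pi * T) ^ 2)) \<longlongrightarrow> 0) at_top"
    by real_asymp
  hence "((\<lambda>T. F c T - F (c - 1) T - deriv g (of_real c)) \<longlongrightarrow> 0) at_top"
  proof (rule Lim_null_comparison[rotated])
    have "norm (F c T - F (c - 1) T - deriv g (of_real c)) \<le> pi * (C * (c + 3 + T) ^ N / sinh (pi * T) ^ 2)"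
      if "0 < T" for T
      unfolding F_def f_def by (rule truncated_shift[OF g c that])
    thus "\<forall>\<^sub>F T in at_top. norm (F c T - F (c - 1) T - deriv g (of_real c)) \<le> pi * (C * (c + 3 + T) ^ N / sinh (pi * T) ^ 2)"
      using eventually_gt_at_top[of 0] by (rule eventually_mono[rotated])
  qed
  moreover have "((\<lambda>T. F c T - F (c - 1) T - deriv g (of_real c)) \<longlongrightarrow>
      bern_mean (\<lambda>w. g (of_real c + w)) - bern_mean (\<lambda>w. g (of_real (c - 1) + w)) - deriv g (of_real c)) at_top"
    using c by (intro tendsto_intros F_lim) auto
  ultimately show ?thesis
    using tendsto_unique[of "at_top :: real filter"] by fastforce
qed

section \<open>Moments of the logistic mean\<close>

lemma slit_bounded_power: "slit_bounded 1 l (\<lambda>v. v ^ l)"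
  unfolding slit_bounded_def
  by (auto intro!: holomorphic_intros power_mono simp: norm_power)

text \<open>Normalisation without evaluating an integral: the left-hand side of the shift identity
  for \<open>g v = v\<close> at \<open>c = 1\<close> is the mean of
  \<open>(1 + w) - w\<close>.\<close>

lemma bern_mean_1: "bern_mean (\<lambda>_. 1) = 1"
proof -
  have int: "integrable lborel (\<lambda>y. of_real (logistic_density y) * (of_real x + bern_line y))" if "0 \<le> x" for x
    using slit_bounded_bern_line(3)[OF slit_bounded_power[of 1] that] by simp
  have "bern_mean (\<lambda>w. of_real 1 + w) - bern_mean (\<lambda>w. of_real (1 - 1) + w) = 1"
    using bern_mean_shift[OF slit_bounded_power[of 1], of 1] by simp
  also have "bern_mean (\<lambda>w. of_real 1 + w) - bern_mean (\<lambda>w. of_real (1 - 1) + w) = bern_mean (\<lambda>_. 1)"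
    using int[of 0] int[of 1] unfolding bern_mean_def
    by (subst Bochner_Integration.integral_diff [symmetric]) (auto simp: algebra_simps)
  finally show ?thesis .
qed

lemma integrable_bern_power: "integrable lborel (\<lambda>y. of_real (logistic_density y) * bern_line y ^ l)"
  using slit_bounded_bern_line(3)[OF slit_bounded_power[of l], of 0] by simp

text \<open>The shift identity at \<open>c = 1\<close> for \<open>v ^ (l + 1)\<close>, with
  \<open>(1 + w) ^ (l + 1)\<close> expanded; its top power cancels against
  \<open>w ^ (l + 1)\<close>.\<close>

lemma bern_mean_power_rec:
  "(\<Sum>j\<le>l. of_nat (Suc l choose j) * bern_mean (\<lambda>w. w ^ j)) = of_nat (Suc l)"
proof -
  have "bern_mean (\<lambda>w. (of_real 1 + w) ^ Suc l) - bern_mean (\<lambda>w. (of_real (1 - 1) + w) ^ Suc l) = of_nat (Suc l)"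
  proof -
    have "deriv (\<lambda>v. v ^ Suc l) (1::complex) = of_nat (Suc l)"
      by (rule DERIV_imp_deriv) (rule derivative_eq_intros refl | simp)+
    thus ?thesis
      using bern_mean_shift[OF slit_bounded_power[of "Suc l"], of 1] by simp
  qed
  also have "bern_mean (\<lambda>w. (of_real 1 + w) ^ Suc l) = bern_mean (\<lambda>w. \<Sum>j\<le>Suc l. of_nat (Suc l choose j) * w ^ j)"
    by (subst add.commute, subst binomial_ring) simp
  also have "\<dots> = (\<Sum>j\<le>Suc l. of_nat (Suc l choose j) * bern_mean (\<lambda>w. w ^ j))"
  proof -
    have "bern_mean (\<lambda>w. \<Sum>j\<le>Suc l. of_nat (Suc l choose j) * w ^ j)
       = (\<integral>y. (\<Sum>j\<le>Suc l. of_nat (Suc l choose j) * (of_real (logistic_density y) * bern_line y ^ j)) \<partial>lborel)"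
      unfolding bern_mean_def by (simp only: sum_distrib_left mult.left_commute)
    also have "\<dots> = (\<Sum>j\<le>Suc l. (\<integral>y. of_nat (Suc l choose j) * (of_real (logistic_density y) * bern_line y ^ j) \<partial>lborel))"
      by (rule Bochner_Integration.integral_sum) (intro integrable_mult_right integrable_bern_power)
    also have "\<dots> = (\<Sum>j\<le>Suc l. of_nat (Suc l choose j) * bern_mean (\<lambda>w. w ^ j))"
      unfolding bern_mean_def by (intro sum.cong refl Bochner_Integration.integral_mult_right_zero)
    finally show ?thesis .
  qed
  finally show ?thesis by simp
qed

subsection \<open>Bernoulli numbers as moments\<close>

lemma bernoulli_altdef: "bernoulli n = fact n * fps_nth (fps_X / (fps_exp 1 - 1)) n"
  by (simp add: bernoulli_def bernpoly_def)

text \<open>The division is exact since both series have subdegree 1.\<close>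

lemma fps_bernoulli_mult: "(fps_X / (fps_exp 1 - 1)) * (fps_exp 1 - 1) = (fps_X :: 'a :: field_char_0 fps)"
proof (rule dvd_div_mult_self)
  have nz: "fps_exp 1 - 1 \<noteq> (0 :: 'a fps)"
    using subdegree_fps_exp_1_minus_1[where 'a = 'a] by (metis subdegree_0 zero_neq_one)
  have "subdegree (fps_exp 1 - 1 :: 'a fps) \<le> subdegree (fps_X :: 'a fps)"
    by (simp only: subdegree_fps_exp_1_minus_1 subdegree_fps_X)
  thus "fps_exp 1 - 1 dvd (fps_X :: 'a fps)"
    using fps_dvd_iff[OF nz, of fps_X] by simp
qed

text \<open>Substitution of \<open>-t\<close> in the generating function: \<open>-t / (exp (-t) - 1)
  = t exp t / (exp t - 1) = t + t / (exp t - 1)\<close>.\<close>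

lemma fps_bernoulli_alternating:
  "Abs_fps (\<lambda>n. (-1) ^ n * bernoulli n / fact n) = (fps_X + fps_X / (fps_exp 1 - 1) :: 'a :: field_char_0 fps)"
  (is "?g = fps_X + ?b")
proof -
  have "?g * (fps_exp (-1) - 1) = - (fps_X :: 'a fps)"
  proof (rule fps_ext)
    fix n
    have "fps_nth (?g * (fps_exp (-1) - 1)) n = (\<Sum>i=0..n. ((-1) ^ i * fps_nth ?b i) * ((-1) ^ (n - i) * fps_nth (fps_exp 1 - 1) (n - i)))"
      unfolding fps_mult_nth by (intro sum.cong refl) (auto simp: bernoulli_altdef power_0_left)
    also have "\<dots> = (\<Sum>i=0..n. (-1) ^ n * (fps_nth ?b i * fps_nth (fps_exp 1 - 1) (n - i)))"
    proof (intro sum.cong refl)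
      fix i assume "i \<in> {0..n}"
      hence "(-1) ^ n = (-1 :: 'a) ^ i * (-1) ^ (n - i)" by (simp flip: power_add)
      thus "((-1) ^ i * fps_nth ?b i) * ((-1) ^ (n - i) * fps_nth (fps_exp 1 - 1) (n - i)) = (-1) ^ n * (fps_nth ?b i * fps_nth (fps_exp 1 - 1) (n - i))"
        by (simp only: mult_ac)
    qed
    also have "\<dots> = (-1) ^ n * fps_nth (?b * (fps_exp 1 - 1)) n"
      by (simp add: fps_mult_nth sum_distrib_left)
    also have "\<dots> = fps_nth (- fps_X) n"
      by (simp only: fps_bernoulli_mult) simp
    finally show "fps_nth (?g * (fps_exp (-1) - 1)) n = fps_nth (- fps_X :: 'a fps) n" .
  qed
  hence "?g * (fps_exp (-1) - 1) * fps_exp 1 = - fps_X * fps_exp 1" by simp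
  moreover have "?g * (fps_exp (-1) - 1) * fps_exp 1 = ?g * (fps_exp (-1) * fps_exp 1 - fps_exp 1)"
    by (simp only: mult.assoc left_diff_distrib mult_1_left)
  ultimately have "?g * (fps_exp (-1) * fps_exp 1 - fps_exp 1) = - fps_X * fps_exp 1"
    by simp
  also have "fps_exp (-1) * fps_exp 1 = (1 :: 'a fps)"
    by (simp flip: fps_exp_add_mult)
  finally have "?g * (fps_exp 1 - 1) = fps_X * fps_exp 1"
    by (simp add: algebra_simps)
  also have "\<dots> = fps_X * (fps_exp 1 - 1) + ?b * (fps_exp 1 - 1)"
    by (simp only: fps_bernoulli_mult) (simp add: algebra_simps)
  also have "\<dots> = (fps_X + ?b) * (fps_exp 1 - 1)" by (simp only: distrib_right)
  finally show ?thesis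
    using subdegree_fps_exp_1_minus_1[where 'a = 'a] by (metis mult_right_cancel subdegree_0 zero_neq_one)
qed

lemma bernoulli_alternating:
  "(-1) ^ n * bernoulli n = bernoulli n + (if n = 1 then 1 else (0 :: 'a :: field_char_0))"
proof -
  have "((-1) ^ n * bernoulli n / fact n :: 'a) = fps_nth (fps_X + fps_X / (fps_exp 1 - 1)) n"
    by (simp only: fps_bernoulli_alternating [symmetric] fps_nth_Abs_fps)
  hence "((-1) ^ n * bernoulli n / fact n :: 'a) = bernoulli n / fact n + (if n = 1 then 1 else 0)"
    by (simp add: bernoulli_altdef)
  thus ?thesis by (auto simp: field_simps)
qed

lemma bernoulli_rec:
  "(\<Sum>j\<le>l. of_nat (Suc l choose j) * bernoulli j) = (if l = 0 then 1 else (0 :: 'a :: field_char_0))"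
proof -
  define n where "n = Suc l"
  have "fps_nth fps_X n = (\<Sum>i=0..n. fps_nth (fps_X / (fps_exp 1 - 1)) i * fps_nth (fps_exp 1 - 1 :: 'a fps) (n - i))"
    by (simp only: fps_mult_nth [symmetric] fps_bernoulli_mult)
  also have "\<dots> = (\<Sum>i\<le>l. bernoulli i / fact i * (1 / fact (n - i)))"
    by (intro sum.mono_neutral_cong_right) (auto simp: n_def bernoulli_altdef not_le le_Suc_eq)
  finally have "fact n * fps_nth fps_X n = (\<Sum>i\<le>l. fact n * (bernoulli i / fact i * (1 / fact (n - i)) :: 'a))"
    by (simp only: sum_distrib_left)
  also have "\<dots> = (\<Sum>i\<le>l. of_nat (n choose i) * bernoulli i)"
    by (intro sum.cong refl) (simp add: n_def binomial_fact)
  finally show ?thesis by (simp add: n_def split: if_splits)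
qed

text \<open>Both sides satisfy the same recursion, whose leading coefficient \<open>l + 1\<close> is
  nonzero. The alternating sign alters only the Bernoulli number of index 1; for
  \<open>l > 0\<close> the extra term is \<open>l + 1\<close>, which turns the right-hand side 0 of
  \<open>bernoulli_rec\<close> into that of \<open>bern_mean_power_rec\<close>.\<close>

lemma bern_mean_power: "bern_mean (\<lambda>w. w ^ l) = (-1) ^ l * bernoulli l"
proof (induction l rule: less_induct)
  case (less l)
  have "(\<Sum>j\<le>l. of_nat (Suc l choose j) * bern_mean (\<lambda>w. w ^ j)) = of_nat (Suc l)"
    by (rule bern_mean_power_rec)
  moreover have "(\<Sum>j\<le>l. of_nat (Suc l choose j) * ((-1) ^ j * bernoulli j)) = (of_nat (Suc l) :: complex)"
  proof -
    have "(\<Sum>j\<le>l. of_nat (Suc l choose j) * ((-1) ^ j * bernoulli j)) =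
       (\<Sum>j\<le>l. of_nat (Suc l choose j) * bernoulli j) + (\<Sum>j\<le>l. if j = 1 then of_nat (Suc l) else (0 :: complex))"
      unfolding bernoulli_alternating sum.distrib [symmetric] by (intro sum.cong refl) (auto simp: algebra_simps)
    thus ?thesis unfolding bernoulli_rec by (cases "l = 0") auto
  qed
  moreover have "{..l} = insert l {..<l}" by auto
  moreover have "(\<Sum>j<l. of_nat (Suc l choose j) * bern_mean (\<lambda>w. w ^ j)) = (\<Sum>j<l. of_nat (Suc l choose j) * ((-1) ^ j * bernoulli j))"
    by (intro sum.cong refl) (simp add: less)
  ultimately have
      "of_nat (Suc l) * bern_mean (\<lambda>w. w ^ l) + (\<Sum>j<l. of_nat (Suc l choose j) * ((-1) ^ j * bernoulli j)) = of_nat (Suc l)"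
      "of_nat (Suc l) * ((-1) ^ l * bernoulli l) + (\<Sum>j<l. of_nat (Suc l choose j) * ((-1) ^ j * bernoulli j)) = (of_nat (Suc l) :: complex)"
    by simp_all
  hence "of_nat (Suc l) * bern_mean (\<lambda>w. w ^ l) = of_nat (Suc l) * ((-1) ^ l * bernoulli l)"
    by (metis add_right_cancel)
  thus ?case by (simp del: of_nat_Suc)
qed

text \<open>The harmonic sums are stated over the reals, whereas the means are complex. The
  recursion determines the numbers over either field, so the embedding respects them.\<close>

lemma of_real_bernoulli: "of_real (bernoulli n) = (bernoulli n :: complex)"
proof (induction n rule: less_induct)
  case (less l)
  have "of_real (\<Sum>j\<le>l. of_nat (Suc l choose j) * bernoulli j) = (\<Sum>j\<le>l. of_nat (Suc l choose j) * bernoulli j :: complex)"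
    unfolding bernoulli_rec by simp
  moreover have "{..l} = insert l {..<l}" by auto
  moreover have "(\<Sum>j<l. of_nat (Suc l choose j) * of_real (bernoulli j)) = (\<Sum>j<l. of_nat (Suc l choose j) * (bernoulli j :: complex))"
    by (intro sum.cong refl) (simp add: less)
  ultimately have "of_nat (Suc l) * of_real (bernoulli l) = of_nat (Suc l) * (bernoulli l :: complex)"
    by simp
  thus ?case by (simp del: of_nat_Suc)
qed

lemma bernoulli_0: "bernoulli 0 = (1 :: 'a :: field_char_0)"
  using bernoulli_rec[of 0, where 'a = 'a] by simp

lemma bernoulli_1: "bernoulli (Suc 0) = (- 1 / 2 :: 'a :: field_char_0)"
proof -
  have "(2::'a) * bernoulli (Suc 0) = -1"
    using bernoulli_rec[of 1, where 'a = 'a] by (simp add: bernoulli_0 add_eq_0_iff)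
  thus ?thesis by (simp add: field_simps)
qed

lemma bernoulli_odd_eq_0: "odd n \<Longrightarrow> n \<noteq> 1 \<Longrightarrow> bernoulli n = (0 :: 'a :: field_char_0)"
  using bernoulli_alternating[of n, where 'a = 'a] by (simp add: eq_neg_iff_add_eq_0 flip: mult_2)

lemma bernoulli_2: "bernoulli 2 = (1 / 6 :: real)"
  using bernoulli_rec[of 2, where 'a = real]
  by (simp add: numeral_2_eq_2 bernoulli_0 bernoulli_1 field_simps)

lemma bernoulli_4: "bernoulli 4 = (- 1 / 30 :: real)"
proof -
  have "bernoulli 3 = (0 :: real)" by (rule bernoulli_odd_eq_0) auto
  hence "bernoulli (Suc (Suc (Suc 0))) = (0 :: real)" by (simp only: numeral_3_eq_3)
  thus ?thesis
    using bernoulli_rec[of 4, where 'a = real] bernoulli_2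
    by (simp add: eval_nat_numeral bernoulli_0 bernoulli_1 field_simps)
qed

subsection \<open>Contour integrals around the segment from \<open>0\<close> to \<open>- bern_line y\<close>\<close>

lemma rectpath_scale:
  "rectpath (of_real s * a1) (of_real s * a3) = (\<lambda>t. of_real s * rectpath a1 a3 t)"
proof -
  have lp: "linepath (of_real s * a) (of_real s * b) = (\<lambda>t. of_real s * linepath a b t)" for a b
    by (auto simp: linepath_def algebra_simps)
  have C: "Complex (Re (of_real s * z)) (Im (of_real s * w)) = of_real s * Complex (Re z) (Im w)" for z w
    by (simp add: complex_eq_iff)
  show ?thesis
    unfolding rectpath_def Let_def C lp by (auto simp: joinpaths_def)
qed

lemma norm_contour_integral_rectpath_le:
  assumes f: "f contour_integrable_on (rectpath a1 a3)" and a: "Re a1 \<le> Re a3" "Im a1 \<le> Im a3"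
    and B: "0 \<le> B" "\<And>w. w \<in> path_image (rectpath a1 a3) \<Longrightarrow> norm (f w) \<le> B"
  shows "norm (contour_integral (rectpath a1 a3) f) \<le> B * (2 * (Re a3 - Re a1) + 2 * (Im a3 - Im a1))"
proof -
  define a2 a4 where "a2 = Complex (Re a3) (Im a1)" and "a4 = Complex (Re a1) (Im a3)"
  note I = contour_integral_rectpath[OF f, folded a2_def a4_def]
  have img: "path_image (rectpath a1 a3) = closed_segment a1 a2 \<union> closed_segment a2 a3 \<union> closed_segment a3 a4 \<union> closed_segment a4 a1"
    by (simp add: rectpath_def Let_def path_image_join Un_assoc a2_def a4_def)
  have n: "norm (a2 - a1) = Re a3 - Re a1" "norm (a3 - a2) = Im a3 - Im a1"
     "norm (a4 - a3) = Re a3 - Re a1" "norm (a1 - a4) = Im a3 - Im a1"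
    using a by (auto simp: a2_def a4_def cmod_def)
  have b: "norm (contour_integral (linepath a1 a2) f) \<le> B * norm (a2 - a1)"
    "norm (contour_integral (linepath a2 a3) f) \<le> B * norm (a3 - a2)"
    "norm (contour_integral (linepath a3 a4) f) \<le> B * norm (a4 - a3)"
    "norm (contour_integral (linepath a4 a1) f) \<le> B * norm (a1 - a4)"
    using I B(2) unfolding img by (intro contour_integral_bound_linepath B(1); simp)+
  have "norm (contour_integral (rectpath a1 a3) f) \<le> B * (Re a3 - Re a1) + B * (Im a3 - Im a1) + B * (Re a3 - Re a1) + B * (Im a3 - Im a1)"
    unfolding I(1) by (intro norm_triangle_le add_mono b[unfolded n])
  thus ?thesis by (simp add: algebra_simps)
qed

lemma contour_integral_rectpath_sums:
  assumes ul: "uniform_limit (path_image (rectpath a1 a3)) (\<lambda>L w. \<Sum>l<L. f l w) g sequentially"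
    and f: "\<And>l. f l contour_integrable_on (rectpath a1 a3)"
    and g: "g contour_integrable_on (rectpath a1 a3)"
    and a: "Re a1 \<le> Re a3" "Im a1 \<le> Im a3"
  shows "(\<lambda>l. contour_integral (rectpath a1 a3) (f l)) sums contour_integral (rectpath a1 a3) g"
  unfolding sums_def
proof (rule tendstoI)
  fix \<epsilon> :: real assume "\<epsilon> > 0"
  define len where "len = 2 * (Re a3 - Re a1) + 2 * (Im a3 - Im a1)"
  have len: "len \<ge> 0" using a by (simp add: len_def)
  define \<delta> where "\<delta> = \<epsilon> / (len + 1)"
  have \<delta>: "\<delta> > 0" using \<open>\<epsilon> > 0\<close> len by (simp add: \<delta>_def)
  have "\<forall>\<^sub>F L in sequentially. \<forall>w\<in>path_image (rectpath a1 a3). dist (\<Sum>l<L. f l w) (g w) < \<delta>"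
    using uniform_limitD[OF ul \<delta>] .
  thus "\<forall>\<^sub>F L in sequentially. dist (\<Sum>l<L. contour_integral (rectpath a1 a3) (f l)) (contour_integral (rectpath a1 a3) g) < \<epsilon>"
  proof eventually_elim
    case (elim L)
    have int: "(\<lambda>w. \<Sum>l<L. f l w) contour_integrable_on (rectpath a1 a3)"
      using f by (intro contour_integrable_sum) auto
    have "(\<Sum>l<L. contour_integral (rectpath a1 a3) (f l)) - contour_integral (rectpath a1 a3) g
        = contour_integral (rectpath a1 a3) (\<lambda>w. (\<Sum>l<L. f l w) - g w)"
      using f g int by (simp add: contour_integral_diff contour_integral_sum)
    also have "norm \<dots> \<le> \<delta> * len"
      unfolding len_def using elim \<delta> a int g
      by (intro norm_contour_integral_rectpath_le contour_integrable_diff) (auto simp: dist_norm less_imp_le)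
    also have "\<dots> < \<epsilon>"
      using \<open>\<epsilon> > 0\<close> len by (simp add: \<delta>_def field_simps)
    finally show ?case by (simp add: dist_norm)
  qed
qed

text \<open>Orthogonality of the powers, used to read off Laurent coefficients. There is no pole for
  \<open>l <= j\<close>, a simple one for \<open>l = j + 1\<close>, and a single-valued primitive
  off 0 for larger \<open>l\<close>.\<close>

lemma rectpath_integral_power_quotient:
  assumes z: "0 \<in> box a1 a3"
  shows "((\<lambda>w. w ^ j / w ^ l) has_contour_integral (if l = Suc j then 2 * of_real pi * \<i> else 0)) (rectpath a1 a3)"
proof -
  let ?\<Gamma> = "rectpath a1 a3"
  have a: "Re a1 < 0" "0 < Re a3" "Im a1 < 0" "0 < Im a3"
    using z by (auto simp: in_box_complex_iff)
  have nz: "w \<noteq> 0" if "w \<in> path_image ?\<Gamma>" for w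
    using that path_image_rectpath_inter_box[of a1 a3] a z by auto
  consider "l \<le> j" | "l = Suc j" | "l > Suc j" by linarith
  thus ?thesis
  proof cases
    case 1
    have "((\<lambda>w. w ^ (j - l)) has_contour_integral 0) ?\<Gamma>"
      by (rule Cauchy_theorem_convex_simple[of _ UNIV]) (auto intro!: holomorphic_intros)
    hence "((\<lambda>w. w ^ j / w ^ l) has_contour_integral 0) ?\<Gamma>"
      by (rule has_contour_integral_eq) (use nz 1 in \<open>auto simp: power_diff\<close>)
    thus ?thesis using 1 by simp
  next
    case 2
    have "((\<lambda>w. 1 / (w - 0)) has_contour_integral (2 * pi * \<i> * winding_number ?\<Gamma> 0 * 1)) ?\<Gamma>"
      by (rule Cauchy_integral_formula_convex_simple[of UNIV]) (use nz in auto)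
    moreover have "winding_number ?\<Gamma> 0 = 1" by (rule winding_number_rectpath[OF z])
    ultimately have "((\<lambda>w. 1 / w) has_contour_integral (2 * of_real pi * \<i>)) ?\<Gamma>" by simp
    hence "((\<lambda>w. w ^ j / w ^ l) has_contour_integral (2 * of_real pi * \<i>)) ?\<Gamma>"
      by (rule has_contour_integral_eq) (use nz 2 in auto)
    thus ?thesis using 2 by simp
  next
    case 3
    define m where "m = l - j - 2"
    have l: "l = j + m + 2" using 3 by (simp add: m_def)
    have "((\<lambda>w. w ^ j / w ^ l) has_contour_integral 0) ?\<Gamma>"
    proof (rule Cauchy_theorem_primitive[where S = "- {0}" and f = "\<lambda>w. - inverse (w ^ Suc m) / of_nat (Suc m)"])
      fix w :: complex assume "w \<in> - {0}"
      hence w: "w \<noteq> 0" by simp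
      have "((\<lambda>w. w ^ Suc m) has_field_derivative ((1 + of_nat m) * (1 * w ^ m))) (at w within - {0})"
        by (rule DERIV_power_Suc[OF DERIV_ident])
      from DERIV_cdivide[OF DERIV_minus[OF DERIV_inverse'[OF this]], of "of_nat (Suc m)"] w
      have "((\<lambda>w. - inverse (w ^ Suc m) / of_nat (Suc m)) has_field_derivative
              inverse (w ^ Suc m) * (of_nat (Suc m) * w ^ m) * inverse (w ^ Suc m) / of_nat (Suc m)) (at w within - {0})"
        by simp
      also have "inverse (w ^ Suc m) * (of_nat (Suc m) * w ^ m) * inverse (w ^ Suc m) / of_nat (Suc m) = w ^ j / w ^ l"
        using w by (simp add: l field_simps power_add power2_eq_square del: of_nat_Suc)
      finally show "((\<lambda>w. - inverse (w ^ Suc m) / of_nat (Suc m)) has_field_derivative w ^ j / w ^ l) (at w within - {0})" .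
    qed (use nz in auto)
    thus ?thesis using 3 by simp
  qed
qed

text \<open>For \<open>l > 0\<close> the residues at \<open>x\<close> and at 0 cancel. Induction
  avoids computing them: \<open>1 / ((w - x) w ^ (l + 1))\<close> is the difference of
  \<open>1 / ((w - x) w ^ l)\<close> and \<open>1 / w ^ (l + 1)\<close>, divided by
  \<open>x\<close>.\<close>

lemma rectpath_integral_cauchy_quotient:
  assumes z: "0 \<in> box a1 a3" and x: "x \<in> box a1 a3" "x \<noteq> 0"
  shows "((\<lambda>w. 1 / (w - x) / w ^ l) has_contour_integral (if l = 0 then 2 * of_real pi * \<i> else 0)) (rectpath a1 a3)"
proof -
  let ?\<Gamma> = "rectpath a1 a3"
  have a: "Re a1 < 0" "0 < Re a3" "Im a1 < 0" "0 < Im a3"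
    using z by (auto simp: in_box_complex_iff)
  have nz: "w \<noteq> 0" "w \<noteq> x" if "w \<in> path_image ?\<Gamma>" for w
    using that path_image_rectpath_inter_box[of a1 a3] a z x by auto
  show ?thesis
  proof (induction l)
    case 0
    have "((\<lambda>w. 1 / (w - x)) has_contour_integral (2 * pi * \<i> * winding_number ?\<Gamma> x * 1)) ?\<Gamma>"
      by (rule Cauchy_integral_formula_convex_simple[of UNIV]) (use nz in auto)
    moreover have "winding_number ?\<Gamma> x = 1" by (rule winding_number_rectpath[OF x(1)])
    ultimately show ?case by simp
  next
    case (Suc l)
    have "((\<lambda>w. (1 / (w - x) / w ^ l - w ^ 0 / w ^ Suc l) / x) has_contour_integral
        (((if l = 0 then 2 * of_real pi * \<i> else 0) - (if Suc l = Suc 0 then 2 * of_real pi * \<i> else 0)) / x)) ?\<Gamma>"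
      by (intro has_contour_integral_div has_contour_integral_diff Suc.IH rectpath_integral_power_quotient z)
    moreover have "(1 / (w - x) / w ^ l - w ^ 0 / w ^ Suc l) / x = 1 / (w - x) / w ^ Suc l" if "w \<in> path_image ?\<Gamma>" for w
      using nz[OF that] x by (simp add: field_simps)
    ultimately have "((\<lambda>w. 1 / (w - x) / w ^ Suc l) has_contour_integral
        (((if l = 0 then 2 * of_real pi * \<i> else 0) - (if Suc l = Suc 0 then 2 * of_real pi * \<i> else 0)) / x)) ?\<Gamma>"
      by (rule has_contour_integral_eq)
    thus ?case by (simp split: if_splits)
  qed
qed

text \<open>
  For \<open>s = 1\<close> the rectangle encloses the segment from \<open>0\<close> to \<open>- bern_line y\<close> at distance at least
  \<open>1/4\<close> and stays in the half plane \<open>Re w \<le> 1/4\<close>, hence away from every \<open>x \<ge> 1\<close>.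
\<close>

definition slit_rect :: "real \<Rightarrow> real \<Rightarrow> real \<Rightarrow> complex" where
  "slit_rect s y = rectpath (of_real s * Complex (- 3 / 4) (- (\<bar>y\<bar> + 1))) (of_real s * Complex (1 / 4) (\<bar>y\<bar> + 1))"

lemma slit_rect_valid [simp]: "valid_path (slit_rect s y)" "path (slit_rect s y)" "pathfinish (slit_rect s y) = pathstart (slit_rect s y)"
  by (simp_all add: slit_rect_def)

lemma slit_rect_scale: "slit_rect s y = (\<lambda>t. of_real s * slit_rect 1 y t)"
  by (simp add: slit_rect_def rectpath_scale[of s])

lemma path_image_slit_rect:
  assumes "0 < s"
  shows "w \<in> path_image (slit_rect s y) \<longleftrightarrow>
    (- 3 / 4 * s \<le> Re w \<and> Re w \<le> s / 4 \<and> \<bar>Im w\<bar> \<le> s * (\<bar>y\<bar> + 1)) \<and>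
    (Re w = - 3 / 4 * s \<or> Re w = s / 4 \<or> \<bar>Im w\<bar> = s * (\<bar>y\<bar> + 1))"
proof -
  define e where "e = s * (\<bar>y\<bar> + 1)"
  have "0 < e" using assms by (simp add: e_def)
  moreover have "of_real s * Complex (- 3 / 4) (- (\<bar>y\<bar> + 1)) = Complex (- 3 / 4 * s) (- e)"
    "of_real s * Complex (1 / 4) (\<bar>y\<bar> + 1) = Complex (s / 4) e"
    by (simp_all add: complex_eq_iff e_def algebra_simps)
  ultimately show ?thesis unfolding slit_rect_def e_def[symmetric] using assms
    by (simp only: path_image_rectpath_cbox_minus_box complex.sel)
       (auto simp: in_cbox_complex_iff in_box_complex_iff abs_le_iff abs_if)
qed

text \<open>Serves power functions and the logarithm alike. \<open>hc\<close> are the Taylor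
  coefficients of \<open>h\<close> at 1, so \<open>hc l * W ^ l\<close> are the Laurent coefficients
  at infinity of \<open>h (1 + W / w)\<close>.\<close>

locale slit_expansion =
  fixes C :: real and N :: nat and h :: "complex \<Rightarrow> complex" and hc :: "nat \<Rightarrow> complex"
  assumes slit: "slit_bounded C N h"
    and hc_sums: "\<And>z. norm z < 1 \<Longrightarrow> (\<lambda>l. hc l * z ^ l) sums h (1 + z)"
begin

definition seg :: "real \<Rightarrow> complex set" where "seg y = closed_segment 0 (- bern_line y)"

definition slit_fun :: "real \<Rightarrow> complex \<Rightarrow> complex" where "slit_fun y w = h (1 + bern_line y / w)"

text \<open>With \<open>W = bern_line y\<close>, an equation \<open>1 + W / w = r\<close> with
  \<open>r <= 0\<close> means \<open>w = - W / (1 - r)\<close>, and \<open>1 / (1 - r)\<close> lies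
  in the unit interval. So the branch cut is hit only on the segment.\<close>

lemma not_nonpos_Reals:
  assumes "w \<notin> seg y"
  shows "w \<noteq> 0" "1 + bern_line y / w \<notin> \<real>\<^sub>\<le>\<^sub>0"
proof -
  show w: "w \<noteq> 0" using assms by (auto simp: seg_def)
  show "1 + bern_line y / w \<notin> \<real>\<^sub>\<le>\<^sub>0"
  proof
    assume "1 + bern_line y / w \<in> \<real>\<^sub>\<le>\<^sub>0"
    then obtain r where r: "1 + bern_line y / w = of_real r" "r \<le> 0"
      by (auto simp: nonpos_Reals_def)
    hence "bern_line y = - of_real (1 - r) * w"
      using w by (simp add: field_simps)
    moreover have "of_real (1 - r) \<noteq> (0 :: complex)"
      using r by (simp only: of_real_eq_0_iff)
    ultimately have "w = - bern_line y / of_real (1 - r)"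
      by (metis minus_mult_left minus_minus nonzero_mult_div_cancel_left)
    hence "w = (1 / (1 - r)) *\<^sub>R (- bern_line y)"
      by (simp add: scaleR_conv_of_real)
    moreover have "0 \<le> 1 / (1 - r)" "1 / (1 - r) \<le> 1" using r by auto
    ultimately have "w \<in> seg y" unfolding seg_def in_segment
      by (intro exI[of _ "1 / (1 - r)"]) auto
    thus False using assms by simp
  qed
qed

lemma open_compl_seg: "open (- seg y)"
  by (simp add: seg_def open_Compl closed_segment)

lemma slit_fun_holo: "slit_fun y holomorphic_on - seg y"
proof -
  have "h holomorphic_on (- \<real>\<^sub>\<le>\<^sub>0)" using slit by (simp add: slit_bounded_def)
  hence "(h \<circ> (\<lambda>w. 1 + bern_line y / w)) holomorphic_on - seg y"
    by (rule holomorphic_on_compose_gen[rotated])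
       (use not_nonpos_Reals in \<open>auto intro!: holomorphic_intros\<close>)
  thus ?thesis by (simp add: o_def slit_fun_def [abs_def])
qed

lemma seg_bounds:
  assumes "z \<in> seg y"
  shows "- 1 / 2 \<le> Re z" "Re z \<le> 0" "\<bar>Im z\<bar> \<le> \<bar>y\<bar>"
proof -
  obtain u where u: "0 \<le> u" "u \<le> 1" "z = - (u *\<^sub>R bern_line y)"
    using assms by (auto simp: seg_def in_segment)
  show "- 1 / 2 \<le> Re z" "Re z \<le> 0" "\<bar>Im z\<bar> \<le> \<bar>y\<bar>"
    using u by (auto simp: abs_mult mult_left_le_one_le)
qed

lemma slit_rect_avoids_seg:
  assumes s: "1 \<le> s" and w: "w \<in> path_image (slit_rect s y)"
  shows "w \<notin> seg y"
proof
  assume *: "w \<in> seg y"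
  have "\<bar>y\<bar> + 1 \<le> s * (\<bar>y\<bar> + 1)"
    using mult_right_mono[OF s, of "\<bar>y\<bar> + 1"] by simp
  thus False
    using seg_bounds[OF *] w s by (auto simp: path_image_slit_rect)
qed

text \<open>The rectangles are pointwise multiples of the one for \<open>s = 1\<close>. The
  straight-line homotopy therefore runs only through \<open>slit_rect r y\<close> with
  \<open>1 <= r\<close>, and none of these meets the segment. The small rectangle serves the
  estimates, a large one admits the Laurent expansion.\<close>

lemma contour_integral_slit_rect_scale:
  assumes g: "g holomorphic_on - seg y" and s: "1 \<le> s"
  shows "contour_integral (slit_rect 1 y) g = contour_integral (slit_rect s y) g"
proof (rule Cauchy_theorem_homotopic_loops[of "- seg y"])
  show "homotopic_loops (- seg y) (slit_rect 1 y) (slit_rect s y)"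
  proof (rule homotopic_loops_linear)
    fix t :: real assume t: "t \<in> {0..1}"
    show "closed_segment (slit_rect 1 y t) (slit_rect s y t) \<subseteq> - seg y"
    proof
      fix z assume "z \<in> closed_segment (slit_rect 1 y t) (slit_rect s y t)"
      then obtain u where u: "0 \<le> u" "u \<le> 1" "z = (1 - u) *\<^sub>R slit_rect 1 y t + u *\<^sub>R slit_rect s y t"
        by (auto simp: in_segment)
      define r where "r = 1 - u + u * s"
      have "z = of_real r * slit_rect 1 y t"
        unfolding u(3) slit_rect_scale[of s] by (simp add: r_def scaleR_conv_of_real algebra_simps)
      hence "z = slit_rect r y t" by (simp add: slit_rect_scale[of r])
      moreover have "slit_rect r y t \<in> path_image (slit_rect r y)"
        using t by (auto simp: path_image_def)
      moreover have "1 \<le> r" using mult_left_mono[OF s u(1)] by (simp add: r_def)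
      ultimately show "z \<in> - seg y" using slit_rect_avoids_seg[of r z y] by simp
    qed
  qed auto
qed (use g open_compl_seg in auto)

lemma norm_slit_rect_ge:
  assumes "0 < s" "w \<in> path_image (slit_rect s y)"
  shows "s / 4 \<le> norm w"
proof -
  have "s \<le> s * (\<bar>y\<bar> + 1)" using assms(1) by simp
  hence "s / 4 \<le> \<bar>Re w\<bar> \<or> s / 4 \<le> \<bar>Im w\<bar>"
    using assms by (auto simp: path_image_slit_rect)
  thus ?thesis using abs_Re_le_cmod[of w] abs_Im_le_cmod[of w] by linarith
qed

text \<open>Every point of the rectangle has norm at least \<open>s / 4\<close>, so the bound with
  the factor 8 gives \<open>norm (bern_line y / w) <= 1/2\<close> and the Laurent series converges
  uniformly there. The factor \<open>q\<close> stands for a power or a Cauchy kernel.\<close>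

lemma slit_rect_expansion:
  assumes s: "1 \<le> s" "8 * norm (bern_line y) \<le> s"
    and q: "continuous_on (path_image (slit_rect s y)) q"
    and int: "\<And>l. ((\<lambda>w. q w / w ^ l) has_contour_integral I l) (slit_rect s y)"
    and int': "(\<lambda>w. slit_fun y w * q w) contour_integrable_on slit_rect s y"
  shows "(\<lambda>l. hc l * bern_line y ^ l * I l) sums contour_integral (slit_rect s y) (\<lambda>w. slit_fun y w * q w)"
proof -
  let ?P = "path_image (slit_rect s y)" and ?W = "bern_line y"
  have "bounded (q ` ?P)"
    by (intro compact_imp_bounded compact_continuous_image q compact_path_image) auto
  then obtain B where B: "\<And>w. w \<in> ?P \<Longrightarrow> norm (q w) \<le> B"
    by (auto simp: bounded_iff)
  have nz: "w \<noteq> 0" and W: "norm (?W / w) \<le> 1 / 2" if "w \<in> ?P" for w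
  proof -
    have "s / 4 \<le> norm w" using norm_slit_rect_ge[OF _ that] s by simp
    thus "w \<noteq> 0" using s by auto
    thus "norm (?W / w) \<le> 1 / 2" using \<open>s / 4 \<le> norm w\<close> s
      by (simp add: norm_divide divide_simps)
  qed
  have summ: "summable (\<lambda>l. norm (hc l) * (1 / 2) ^ l * B)"
  proof (intro summable_mult2)
    \<comment> \<open>Any point strictly between \<open>1/2\<close> and 1 would do: convergence
      there gives absolute convergence at \<open>1/2\<close>.\<close>
    have "summable (\<lambda>l. hc l * (3 / 4) ^ l)"
      using hc_sums[of "3 / 4"] by (simp add: sums_iff)
    hence "summable (\<lambda>l. norm (hc l * (1 / 2) ^ l))"
      by (rule powser_insidea) simp
    thus "summable (\<lambda>l. norm (hc l) * (1 / 2) ^ l)"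
      by (simp add: norm_mult norm_power norm_divide)
  qed
  have "uniform_limit ?P (\<lambda>L w. \<Sum>l<L. hc l * ?W ^ l * (q w / w ^ l)) (\<lambda>w. \<Sum>l. hc l * ?W ^ l * (q w / w ^ l)) sequentially"
  proof (rule Weierstrass_m_test[OF _ summ])
    fix l w assume w: "w \<in> ?P"
    have "norm (hc l * ?W ^ l * (q w / w ^ l)) = norm (hc l) * norm (?W / w) ^ l * norm (q w)"
      by (simp add: norm_mult norm_divide norm_power power_divide)
    also have "\<dots> \<le> norm (hc l) * (1 / 2) ^ l * B"
      using W[OF w] B[OF w] by (intro mult_mono power_mono) auto
    finally show "norm (hc l * ?W ^ l * (q w / w ^ l)) \<le> norm (hc l) * (1 / 2) ^ l * B" .
  qed
  also have "?this \<longleftrightarrow> uniform_limit ?P (\<lambda>L w. \<Sum>l<L. hc l * ?W ^ l * (q w / w ^ l)) (\<lambda>w. slit_fun y w * q w) sequentially"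
  proof (intro uniform_limit_cong' refl)
    fix w assume w: "w \<in> ?P"
    have "(\<lambda>l. hc l * (?W / w) ^ l * q w) sums (h (1 + ?W / w) * q w)"
      using W[OF w] by (intro sums_mult2 hc_sums) auto
    thus "(\<Sum>l. hc l * ?W ^ l * (q w / w ^ l)) = slit_fun y w * q w"
      by (simp add: sums_iff slit_fun_def power_divide)
  qed
  finally have ul: "uniform_limit ?P (\<lambda>L w. \<Sum>l<L. hc l * ?W ^ l * (q w / w ^ l)) (\<lambda>w. slit_fun y w * q w) sequentially" .
  have int2: "((\<lambda>w. hc l * ?W ^ l * (q w / w ^ l)) has_contour_integral (hc l * ?W ^ l * I l)) (slit_rect s y)" for l
    by (intro has_contour_integral_lmul int)
  have "(\<lambda>l. contour_integral (slit_rect s y) (\<lambda>w. hc l * ?W ^ l * (q w / w ^ l))) sums contour_integral (slit_rect s y) (\<lambda>w. slit_fun y w * q w)"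
    using ul int2 int' s unfolding slit_rect_def
    by (intro contour_integral_rectpath_sums) (auto simp: contour_integrable_on_def mult_left_mono intro!: mult_left_mono)
  thus ?thesis by (simp only: contour_integral_unique[OF int2])
qed

end

subsection \<open>Waring expansion of the Cauchy kernel\<close>

text \<open>These are partial products of Euler's product for \<open>sinh (pi e) / (pi e)\<close>,
  that is, for the sine at \<open>i pi e\<close>. They increase with \<open>K\<close>, so the limit
  bounds each of them, and \<open>pi e >= 1\<close> lets the denominator be dropped.\<close>

lemma prod_one_plus_square_le:
  fixes e :: real
  assumes "1 \<le> e"
  shows "(\<Prod>i<K. 1 + e ^ 2 / (real i + 1) ^ 2) \<le> exp (pi * e)"
proof -
  define X where "X = (\<lambda>n. pi * e * (\<Prod>i<n. 1 + e ^ 2 / (real i + 1) ^ 2))"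
  define z where "z = \<i> * complex_of_real e"
  have "(\<lambda>n. norm (of_real pi * z * (\<Prod>k=1..n. 1 - z^2 / of_nat k^2))) \<longlonglongrightarrow> norm (sin (of_real pi * z))"
    by (intro tendsto_norm sin_product_formula_complex)
  also have "(\<lambda>n. norm (of_real pi * z * (\<Prod>k=1..n. 1 - z^2 / of_nat k^2))) = X"
  proof
    fix n
    have "(\<Prod>k=1..n. 1 - z^2 / of_nat k^2) = (\<Prod>i<n. 1 - z^2 / of_nat (Suc i)^2)"
      by (rule prod.reindex_bij_witness[of _ Suc "\<lambda>i. i - 1"]) auto
    also have "\<dots> = of_real (\<Prod>i<n. 1 + e ^ 2 / (real i + 1) ^ 2)"
      by (simp add: z_def power_mult_distrib add_ac)
    finally have "norm (of_real pi * z * (\<Prod>k=1..n. 1 - z^2 / of_nat k^2)) = pi * \<bar>e\<bar> * \<bar>\<Prod>i<n. 1 + e ^ 2 / (real i + 1) ^ 2\<bar>"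
      by (simp only: norm_mult norm_of_real) (simp add: z_def norm_mult)
    thus "norm (of_real pi * z * (\<Prod>k=1..n. 1 - z^2 / of_nat k^2)) = X n"
      using assms by (simp add: X_def prod_nonneg)
  qed
  finally have lim: "X \<longlonglongrightarrow> norm (sin (of_real pi * z))" .
  have "incseq X"
  proof (rule incseq_SucI)
    fix n
    have "(\<Prod>i<n. 1 + e ^ 2 / (real i + 1) ^ 2) * 1 \<le> (\<Prod>i<n. 1 + e ^ 2 / (real i + 1) ^ 2) * (1 + e ^ 2 / (real n + 1) ^ 2)"
      by (intro mult_left_mono prod_nonneg) auto
    thus "X n \<le> X (Suc n)"
      using assms unfolding X_def by (intro mult_left_mono) auto
  qed
  hence "X K \<le> norm (sin (of_real pi * z))"
    using lim by (rule incseq_le)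
  also have "\<dots> \<le> exp \<bar>Im (of_real pi * z)\<bar>"
  proof -
    have "norm (sin w) \<le> exp \<bar>Im w\<bar>" for w :: complex
    proof -
      have "norm (exp (\<i> * w) - exp (- (\<i> * w))) \<le> exp \<bar>Im w\<bar> + exp \<bar>Im w\<bar>"
        by (rule order_trans[OF norm_triangle_ineq4]) (intro add_mono; simp)
      thus ?thesis by (simp add: sin_exp_eq norm_divide norm_mult)
    qed
    thus ?thesis .
  qed
  finally have "X K \<le> exp (pi * e)"
    using assms by (simp add: z_def)
  moreover have "1 * (\<Prod>i<K. 1 + e ^ 2 / (real i + 1) ^ 2) \<le> X K"
    unfolding X_def using assms pi_gt3 mult_mono[of 1 pi 1 e]
    by (intro mult_right_mono prod_nonneg) auto
  ultimately show ?thesis by simp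
qed

text \<open>With \<open>t = i + 1\<close>, the square of the factor of index \<open>i\<close> is at
  most \<open>(t / (t + 1)) (1 + e^2 / t^2)\<close>. The first part telescopes to
  \<open>1 / (K + 1)\<close>, the second falls under Euler's product; a square root
  finishes.\<close>

lemma pochhammer_quotient_bound:
  fixes w :: complex and x e :: real
  assumes w: "- 3 / 4 \<le> Re w" "Re w \<le> 1 / 4" "\<bar>Im w\<bar> \<le> e" and e: "1 \<le> e" and x: "1 \<le> x"
  shows "norm (pochhammer (w + 1) K / pochhammer (of_real x + 1) K) \<le> exp (pi * e / 2) / sqrt (real K + 1)"
proof -
  have fac: "(norm (w + 1 + of_nat i) / (x + 1 + real i)) ^ 2 \<le> ((real i + 1) / (real i + 2)) * (1 + e ^ 2 / (real i + 1) ^ 2)" for i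
  proof -
    define t where "t = real i + 1"
    have t: "1 \<le> t" by (simp add: t_def)
    have "\<bar>Re w + t\<bar> \<le> t + 1 / 4" using w t by auto
    hence "(Re w + t) ^ 2 \<le> (t + 1 / 4) ^ 2" by (metis abs_ge_zero power2_abs power_mono)
    moreover have "(Im w) ^ 2 \<le> e ^ 2" using w by (metis abs_ge_zero power2_abs power_mono)
    moreover have "norm (w + 1 + of_nat i) ^ 2 = (Re w + t) ^ 2 + (Im w) ^ 2"
      by (simp add: cmod_power2 t_def add_ac)
    ultimately have n: "norm (w + 1 + of_nat i) ^ 2 \<le> (t + 1 / 4) ^ 2 + e ^ 2" by linarith
    have "(norm (w + 1 + of_nat i) / (x + 1 + real i)) ^ 2 = norm (w + 1 + of_nat i) ^ 2 / (x + t) ^ 2"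
      by (simp add: power_divide t_def add_ac)
    also have "\<dots> \<le> ((t + 1 / 4) ^ 2 + e ^ 2) / (t + 1) ^ 2"
      using n x t by (intro frac_le power_mono) auto
    also have "\<dots> \<le> (t / (t + 1)) * (1 + e ^ 2 / t ^ 2)"
    proof -
      have *: "t * 1 \<le> t * t" "0 \<le> e * e" using t by (intro mult_left_mono) auto
      \<comment> \<open>Right minus left is \<open>t^2 / 2 - t / 16 + e^2\<close>, which is positive
        for \<open>t >= 1\<close>.\<close>
      hence "((t + 1 / 4) ^ 2 + e ^ 2) * t \<le> (t ^ 2 + e ^ 2) * (t + 1)"
        by (simp add: power2_eq_square algebra_simps, use * t in linarith)
      hence "((t + 1 / 4) ^ 2 + e ^ 2) * t / (t * (t + 1) ^ 2) \<le> (t ^ 2 + e ^ 2) * (t + 1) / (t * (t + 1) ^ 2)"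
        using t by (intro divide_right_mono) auto
      moreover have "((t + 1 / 4) ^ 2 + e ^ 2) * t / (t * (t + 1) ^ 2) = ((t + 1 / 4) ^ 2 + e ^ 2) / (t + 1) ^ 2"
        using t by simp
      moreover have "(t ^ 2 + e ^ 2) * (t + 1) / (t * (t + 1) ^ 2) = (t / (t + 1)) * (1 + e ^ 2 / t ^ 2)"
        using t by (simp add: power2_eq_square divide_simps)
      ultimately show ?thesis by simp
    qed
    finally show ?thesis by (simp add: t_def add_ac)
  qed
  have eq: "norm (pochhammer (w + 1) K / pochhammer (of_real x + 1) K) = (\<Prod>i<K. norm (w + 1 + of_nat i) / (x + 1 + real i))"
  proof -
    have "norm (of_real x + 1 + of_nat i :: complex) = x + 1 + real i" for i
    proof -
      have "of_real x + 1 + of_nat i = complex_of_real (x + 1 + real i)" by simp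
      thus ?thesis using x by (simp only: norm_of_real)
    qed
    thus ?thesis
      by (simp add: pochhammer_prod norm_divide prod_dividef atLeast0LessThan flip: prod_norm)
  qed
  have tel: "(\<Prod>i<K. (real i + 1) / (real i + 2)) = 1 / (real K + 1)"
    by (induction K) (auto simp: field_simps)
  have "(norm (pochhammer (w + 1) K / pochhammer (of_real x + 1) K)) ^ 2 = (\<Prod>i<K. (norm (w + 1 + of_nat i) / (x + 1 + real i)) ^ 2)"
    unfolding eq by (rule prod_power_distrib)
  also have "\<dots> \<le> (\<Prod>i<K. ((real i + 1) / (real i + 2)) * (1 + e ^ 2 / (real i + 1) ^ 2))"
    by (intro prod_mono conjI fac) auto
  also have "\<dots> = 1 / (real K + 1) * (\<Prod>i<K. 1 + e ^ 2 / (real i + 1) ^ 2)"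
    by (simp only: prod.distrib tel)
  also have "\<dots> \<le> 1 / (real K + 1) * exp (pi * e)"
    by (intro mult_left_mono prod_one_plus_square_le e) auto
  also have "\<dots> = (exp (pi * e / 2) / sqrt (real K + 1)) ^ 2"
    by (simp add: power_divide flip: exp_double)
  finally show ?thesis by (rule power2_le_imp_le) auto
qed

text \<open>Waring's series with its exact remainder. With
  \<open>Q k = pochhammer (w + 1) k / pochhammer (x + 1) k\<close>, the summand of index
  \<open>k\<close> is \<open>(Q k - Q (k + 1)) / (x - w)\<close>, so the sum telescopes.\<close>

lemma sum_pochhammer_quotient:
  fixes w x :: "'a :: field_char_0"
  assumes "x \<noteq> w" "\<And>k. pochhammer (x + 1) k \<noteq> 0"
  shows "(\<Sum>k<K. pochhammer (w + 1) k / pochhammer (x + 1) (Suc k)) = (1 - pochhammer (w + 1) K / pochhammer (x + 1) K) / (x - w)"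
proof (induction K)
  case (Suc K)
  have "x + 1 + of_nat K \<noteq> 0" using assms(2)[of "Suc K"] by (simp add: pochhammer_Suc)
  moreover have "(1 - P / Q) / (x - w) + P / (Q * d) = (1 - P * e / (Q * d)) / (x - w)"
    if "Q \<noteq> 0" "d \<noteq> 0" "d - e = x - w" for P Q d e :: 'a
  proof -
    have "e = d - x + w" using that(3) by (simp add: algebra_simps)
    thus ?thesis using that(1,2) assms(1)
      by (simp add: divide_simps) (simp add: algebra_simps)
  qed
  ultimately show ?case using Suc.IH assms(2)[of K] by (simp add: pochhammer_Suc)
qed auto

lemma pochhammer_real_nonzero: "1 \<le> x \<Longrightarrow> pochhammer (complex_of_real x + 1) k \<noteq> 0"
proof -
  assume "1 \<le> x"
  hence "pochhammer (x + 1) k \<noteq> 0" using pochhammer_pos[of "x + 1" k] by simp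
  moreover have "pochhammer (complex_of_real x + 1) k = of_real (pochhammer (x + 1) k)"
    by (simp add: pochhammer_of_real [symmetric])
  ultimately show ?thesis by simp
qed

text \<open>\<open>w * pochhammer (w + 1) k\<close> is the rising factorial of \<open>w\<close> of
  length \<open>k + 1\<close>; hence the index \<open>Suc k\<close> of the Stirling numbers.\<close>

lemma pochhammer_plus1_conv_stirling:
  fixes w :: "'a :: field_char_0"
  assumes "w \<noteq> 0"
  shows "w ^ a * pochhammer (w + 1) k = (\<Sum>l=1..Suc k. of_nat (stirling (Suc k) l) * w ^ (l + a - 1))"
proof -
  have "w * (w ^ a * pochhammer (w + 1) k) = w ^ a * pochhammer w (Suc k)"
    by (simp add: pochhammer_rec)
  also have "\<dots> = (\<Sum>l\<le>Suc k. w ^ a * (of_nat (stirling (Suc k) l) * w ^ l))"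
    by (simp only: stirling_pochhammer [symmetric] sum_distrib_left)
  also have "\<dots> = (\<Sum>l=1..Suc k. w ^ a * (of_nat (stirling (Suc k) l) * w ^ l))"
    by (intro sum.mono_neutral_right) (auto simp: not_le)
  also have "\<dots> = w * (\<Sum>l=1..Suc k. of_nat (stirling (Suc k) l) * w ^ (l + a - 1))"
    unfolding sum_distrib_left
  proof (intro sum.cong refl)
    fix l assume "l \<in> {1..Suc k}"
    then obtain l' where "l = Suc l'" by (cases l) auto
    thus "w ^ a * (of_nat (stirling (Suc k) l) * w ^ l) = w * (of_nat (stirling (Suc k) l) * w ^ (l + a - 1))"
      by (simp add: power_add mult_ac)
  qed
  finally show ?thesis using assms by simp
qed

subsection \<open>Factorial series with error bound\<close>

text \<open>The power of 8 and \<open>exp (pi / 2)\<close> come from the contour estimate, the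
  bracket and the integral from \<open>logistic_density_times_le\<close>. The argument will be
  \<open>N + a\<close>, so the function expanded enters the error bound only through
  \<open>C\<close> and \<open>N\<close>.\<close>

definition expansion_const :: "nat \<Rightarrow> real" where
  "expansion_const n = 8 ^ (n + 1) * exp (pi / 2) * (2 * pi * fact (n + 1) * exp 1) * (\<integral>y. exp (- \<bar>y\<bar>) \<partial>lborel)"

context slit_expansion
begin

lemma slit_rect_integrable:
  assumes "g holomorphic_on - seg y" "1 \<le> s"
  shows "g contour_integrable_on slit_rect s y"
  by (rule contour_integrable_holomorphic_simple[OF assms(1) open_compl_seg])
     (use slit_rect_avoids_seg[OF assms(2)] in auto)

text \<open>On a large rectangle the Laurent series may be integrated term by term, and only the
  coefficient of index \<open>j + 1\<close> survives; deformation carries the value over to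
  \<open>slit_rect 1 y\<close>.\<close>

lemma integral_slit_fun_power:
  "((\<lambda>w. slit_fun y w * w ^ j) has_contour_integral (2 * of_real pi * \<i> * (hc (Suc j) * bern_line y ^ Suc j))) (slit_rect 1 y)"
proof -
  define s where "s = 1 + 8 * norm (bern_line y)"
  have s: "1 \<le> s" by (simp add: s_def)
  have holo: "(\<lambda>w. slit_fun y w * w ^ j) holomorphic_on - seg y"
    by (intro holomorphic_intros slit_fun_holo)
  note int = slit_rect_integrable[OF holo]
  have e: "0 < s * (\<bar>y\<bar> + 1)" using s by simp
  have e': "s * (- \<bar>y\<bar> - 1) < 0" by (rule mult_pos_neg) (use s in auto)
  have box: "0 \<in> box (of_real s * Complex (- 3 / 4) (- (\<bar>y\<bar> + 1))) (of_real s * Complex (1 / 4) (\<bar>y\<bar> + 1))"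
    using e e' s by (auto simp: in_box_complex_iff)
  have "(\<lambda>l. hc l * bern_line y ^ l * (if l = Suc j then 2 * of_real pi * \<i> else 0)) sums contour_integral (slit_rect s y) (\<lambda>w. slit_fun y w * w ^ j)"
  proof (rule slit_rect_expansion[OF s _ _ _ int[OF s]])
    show "8 * norm (bern_line y) \<le> s" by (simp add: s_def)
    show "((\<lambda>w. w ^ j / w ^ l) has_contour_integral (if l = Suc j then 2 * of_real pi * \<i> else 0)) (slit_rect s y)" for l
      unfolding slit_rect_def by (rule rectpath_integral_power_quotient[OF box])
  qed (intro continuous_intros)
  moreover have "(\<lambda>l. hc l * bern_line y ^ l * (if l = Suc j then 2 * of_real pi * \<i> else 0)) sums (hc (Suc j) * bern_line y ^ Suc j * (2 * of_real pi * \<i>))"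
    using sums_single[of "Suc j" "\<lambda>l. hc l * bern_line y ^ l * (2 * of_real pi * \<i>)"]
    by (simp add: if_distrib if_distribR cong: if_cong)
  ultimately have "contour_integral (slit_rect s y) (\<lambda>w. slit_fun y w * w ^ j) = hc (Suc j) * bern_line y ^ Suc j * (2 * of_real pi * \<i>)"
    by (rule sums_unique2)
  thus ?thesis
    using has_contour_integral_integral[OF int[of 1]] contour_integral_slit_rect_scale[OF holo s]
    by (simp add: mult_ac)
qed

text \<open>Cauchy's formula for the exterior of the rectangle: \<open>x\<close> lies outside
  \<open>slit_rect 1 y\<close>, and the value \<open>hc 0\<close> at infinity has to be
  subtracted.\<close>

lemma integral_slit_fun_cauchy:
  assumes x: "1 \<le> x"
  shows "((\<lambda>w. slit_fun y w / (of_real x - w)) has_contour_integral (2 * of_real pi * \<i> * (slit_fun y (of_real x) - hc 0))) (slit_rect 1 y)"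
proof -
  define s where "s = 1 + 8 * norm (bern_line y) + 8 * x"
  have n: "0 \<le> norm (bern_line y)" by simp
  have s: "1 \<le> s" "8 * norm (bern_line y) \<le> s" "x < s / 4"
    unfolding s_def using x n by (simp_all, linarith?)
  let ?x = "complex_of_real x"
  have x_seg: "?x \<notin> seg y" using seg_bounds(2)[of ?x y] x by auto
  \<comment> \<open>The difference quotient has a removable singularity at \<open>x\<close>, so its
    contour may cross \<open>x\<close> on the way to the large rectangle, where
    \<open>slit_fun\<close> times the kernel and the bare kernel are integrated separately.\<close>
  define \<psi> where "\<psi> = (\<lambda>w. if w = ?x then deriv (slit_fun y) ?x else (slit_fun y w - slit_fun y ?x) / (w - ?x))"
  have \<psi>_holo: "\<psi> holomorphic_on - seg y"
    unfolding \<psi>_def by (intro pole_lemma_open slit_fun_holo open_compl_seg)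
  have eq: "contour_integral (slit_rect 1 y) \<psi> = contour_integral (slit_rect s y) \<psi>"
    by (rule contour_integral_slit_rect_scale[OF \<psi>_holo s(1)])
  have ne1: "w \<noteq> ?x" if "w \<in> path_image (slit_rect 1 y)" for w
    using that x by (auto simp: path_image_slit_rect)
  have e: "0 < s * (\<bar>y\<bar> + 1)" using s by simp
  have e': "s * (- \<bar>y\<bar> - 1) < 0" by (rule mult_pos_neg) (use s in auto)
  have box: "0 \<in> box (of_real s * Complex (- 3 / 4) (- (\<bar>y\<bar> + 1))) (of_real s * Complex (1 / 4) (\<bar>y\<bar> + 1))"
    "?x \<in> box (of_real s * Complex (- 3 / 4) (- (\<bar>y\<bar> + 1))) (of_real s * Complex (1 / 4) (\<bar>y\<bar> + 1))"
    using e e' s x by (auto simp: in_box_complex_iff)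
  have ne2: "w \<noteq> ?x" if "w \<in> path_image (slit_rect s y)" for w
    using that x s e by (auto simp: path_image_slit_rect)
  have int_s: "(\<lambda>w. slit_fun y w * (1 / (w - ?x))) contour_integrable_on slit_rect s y"
    by (rule contour_integrable_holomorphic_simple[of _ "- seg y - {?x}"])
       (use slit_rect_avoids_seg[OF s(1)] ne2 open_compl_seg in
         \<open>auto intro!: holomorphic_intros holomorphic_on_subset[OF slit_fun_holo]\<close>)
  have "(\<lambda>l. hc l * bern_line y ^ l * (if l = 0 then 2 * of_real pi * \<i> else 0)) sums contour_integral (slit_rect s y) (\<lambda>w. slit_fun y w * (1 / (w - ?x)))"
  proof (rule slit_rect_expansion[OF s(1,2) _ _ int_s])
    show "continuous_on (path_image (slit_rect s y)) (\<lambda>w. 1 / (w - ?x))"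
      using ne2 by (auto intro!: continuous_intros)
    show "((\<lambda>w. 1 / (w - ?x) / w ^ l) has_contour_integral (if l = 0 then 2 * of_real pi * \<i> else 0)) (slit_rect s y)" for l
      unfolding slit_rect_def by (rule rectpath_integral_cauchy_quotient[OF box]) (use x in auto)
  qed
  moreover have "(\<lambda>l. hc l * bern_line y ^ l * (if l = 0 then 2 * of_real pi * \<i> else 0)) sums (hc 0 * (2 * of_real pi * \<i>))"
    using sums_single[of 0 "\<lambda>l. hc l * bern_line y ^ l * (2 * of_real pi * \<i>)"]
    by (simp add: if_distrib if_distribR cong: if_cong)
  ultimately have I1: "contour_integral (slit_rect s y) (\<lambda>w. slit_fun y w * (1 / (w - ?x))) = hc 0 * (2 * of_real pi * \<i>)"
    by (rule sums_unique2)
  have "((\<lambda>w. 1 / (w - ?x) / w ^ 0) has_contour_integral (if (0::nat) = 0 then 2 * of_real pi * \<i> else 0)) (slit_rect s y)"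
    unfolding slit_rect_def by (rule rectpath_integral_cauchy_quotient[OF box]) (use x in auto)
  hence I2: "((\<lambda>w. 1 / (w - ?x)) has_contour_integral (2 * of_real pi * \<i>)) (slit_rect s y)" by simp
  have "((\<lambda>w. slit_fun y w * (1 / (w - ?x)) - slit_fun y ?x * (1 / (w - ?x))) has_contour_integral (hc 0 * (2 * of_real pi * \<i>) - slit_fun y ?x * (2 * of_real pi * \<i>))) (slit_rect s y)"
    using has_contour_integral_integral[OF int_s] I1 I2
    by (intro has_contour_integral_diff has_contour_integral_lmul) auto
  hence "(\<psi> has_contour_integral (hc 0 * (2 * of_real pi * \<i>) - slit_fun y ?x * (2 * of_real pi * \<i>))) (slit_rect s y)"
    by (rule has_contour_integral_eq) (use ne2 in \<open>auto simp: \<psi>_def diff_divide_distrib\<close>)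
  hence "contour_integral (slit_rect 1 y) \<psi> = hc 0 * (2 * of_real pi * \<i>) - slit_fun y ?x * (2 * of_real pi * \<i>)"
    by (simp add: contour_integral_unique eq)
  hence I3: "(\<psi> has_contour_integral (hc 0 * (2 * of_real pi * \<i>) - slit_fun y ?x * (2 * of_real pi * \<i>))) (slit_rect 1 y)"
    using has_contour_integral_integral[OF slit_rect_integrable[OF \<psi>_holo, of 1]] by simp
  \<comment> \<open>The half plane \<open>Re w < 1\<close> contains the small rectangle but not
    \<open>x\<close>.\<close>
  have "((\<lambda>w. 1 / (w - ?x)) has_contour_integral 0) (slit_rect 1 y)"
  proof (rule Cauchy_theorem_convex_simple[of _ "{w. Re w < 1}"])
    show "(\<lambda>w. 1 / (w - ?x)) holomorphic_on {w. Re w < 1}"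
      using x by (auto intro!: holomorphic_intros)
    show "path_image (slit_rect 1 y) \<subseteq> {w. Re w < 1}"
      by (auto simp: path_image_slit_rect)
  qed (auto simp: convex_halfspace_Re_lt)
  hence "((\<lambda>w. - (\<psi> w + slit_fun y ?x * (1 / (w - ?x)))) has_contour_integral (- ((hc 0 * (2 * of_real pi * \<i>) - slit_fun y ?x * (2 * of_real pi * \<i>)) + slit_fun y ?x * 0))) (slit_rect 1 y)"
    by (intro has_contour_integral_neg has_contour_integral_add I3 has_contour_integral_lmul)
  hence "((\<lambda>w. slit_fun y w / (?x - w)) has_contour_integral (- ((hc 0 * (2 * of_real pi * \<i>) - slit_fun y ?x * (2 * of_real pi * \<i>)) + slit_fun y ?x * 0))) (slit_rect 1 y)"
  proof (rule has_contour_integral_eq)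
    fix w assume "w \<in> path_image (slit_rect 1 y)"
    hence "w \<noteq> ?x" by (rule ne1)
    thus "- (\<psi> w + slit_fun y ?x * (1 / (w - ?x))) = slit_fun y w / (?x - w)"
      by (simp add: \<psi>_def divide_simps) (simp add: algebra_simps)
  qed
  thus ?thesis by (simp add: algebra_simps)
qed

end

section \<open>The remainder of the factorial series\<close>

context slit_expansion
begin

text \<open>Induction through \<open>w ^ (a + 1) / (x - w) = x w ^ a / (x - w) - w ^ a\<close>. Each
  step peels off one more Laurent coefficient; after averaging, these become the explicit Bernoulli
  terms up to \<open>a\<close>.\<close>

lemma integral_slit_fun_power_cauchy:
  assumes x: "1 \<le> x"
  shows "((\<lambda>w. slit_fun y w * w ^ a / (of_real x - w)) has_contour_integral
     (2 * of_real pi * \<i> * (of_real x ^ a * slit_fun y (of_real x) - (\<Sum>j\<le>a. hc j * bern_line y ^ j * of_real x ^ (a - j))))) (slit_rect 1 y)"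
proof (induction a)
  case 0
  show ?case using integral_slit_fun_cauchy[OF x, of y] by simp
next
  case (Suc a)
  let ?R = "\<lambda>a. of_real x ^ a * slit_fun y (of_real x) - (\<Sum>j\<le>a. hc j * bern_line y ^ j * of_real x ^ (a - j))"
  have "((\<lambda>w. of_real x * (slit_fun y w * w ^ a / (of_real x - w)) - slit_fun y w * w ^ a) has_contour_integral
     (of_real x * (2 * of_real pi * \<i> * ?R a) - 2 * of_real pi * \<i> * (hc (Suc a) * bern_line y ^ Suc a))) (slit_rect 1 y)"
    by (intro has_contour_integral_diff has_contour_integral_lmul Suc.IH integral_slit_fun_power)
  hence "((\<lambda>w. slit_fun y w * w ^ Suc a / (of_real x - w)) has_contour_integral
     (of_real x * (2 * of_real pi * \<i> * ?R a) - 2 * of_real pi * \<i> * (hc (Suc a) * bern_line y ^ Suc a))) (slit_rect 1 y)"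
  proof (rule has_contour_integral_eq)
    fix w assume "w \<in> path_image (slit_rect 1 y)"
    hence "of_real x - w \<noteq> 0" using x by (auto simp: path_image_slit_rect)
    thus "of_real x * (slit_fun y w * w ^ a / (of_real x - w)) - slit_fun y w * w ^ a = slit_fun y w * w ^ Suc a / (of_real x - w)"
      by (simp add: divide_simps) (simp add: algebra_simps)
  qed
  moreover have factor: "p * (q * r) - q * t = q * (p * r - t)" for p q r t :: complex
    by (simp add: algebra_simps)
  moreover have R: "of_real x * ?R a - hc (Suc a) * bern_line y ^ Suc a = ?R (Suc a)"
  proof -
    have "(\<Sum>j\<le>a. hc j * bern_line y ^ j * of_real x ^ (Suc a - j)) = of_real x * (\<Sum>j\<le>a. hc j * bern_line y ^ j * of_real x ^ (a - j))"
      unfolding sum_distrib_left by (intro sum.cong refl) (auto simp: Suc_diff_le)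
    thus ?thesis by (simp add: algebra_simps)
  qed
  ultimately show ?case by (simp only: factor R)
qed

definition remainder :: "real \<Rightarrow> nat \<Rightarrow> nat \<Rightarrow> real \<Rightarrow> complex" where
  "remainder x a K y = of_real x ^ a * slit_fun y (of_real x) - (\<Sum>j\<le>a. hc j * bern_line y ^ j * of_real x ^ (a - j))
     - (\<Sum>k<K. (\<Sum>l=1..Suc k. of_nat (stirling (Suc k) l) * (hc (l + a) * bern_line y ^ (l + a))) / pochhammer (of_real x + 1) (Suc k))"

text \<open>Waring's identity, multiplied by \<open>slit_fun y w * w ^ a\<close> and integrated. The
  kernel and the finite Stirling sums have known integrals, so what is left represents the
  truncation error exactly.\<close>

lemma remainder_integral:
  assumes x: "1 \<le> x"
  shows "((\<lambda>w. slit_fun y w * w ^ a * (pochhammer (w + 1) K / pochhammer (of_real x + 1) K) / (of_real x - w)) has_contour_integral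
     (2 * of_real pi * \<i> * remainder x a K y)) (slit_rect 1 y)"
proof -
  have "((\<lambda>w. slit_fun y w * w ^ a / (of_real x - w) -
         (\<Sum>k<K. (\<Sum>l=1..Suc k. of_nat (stirling (Suc k) l) * (slit_fun y w * w ^ (l + a - 1))) / pochhammer (of_real x + 1) (Suc k)))
     has_contour_integral
     (2 * of_real pi * \<i> * (of_real x ^ a * slit_fun y (of_real x) - (\<Sum>j\<le>a. hc j * bern_line y ^ j * of_real x ^ (a - j))) -
      (\<Sum>k<K. (\<Sum>l=1..Suc k. of_nat (stirling (Suc k) l) * (2 * of_real pi * \<i> * (hc (Suc (l + a - 1)) * bern_line y ^ Suc (l + a - 1)))) / pochhammer (of_real x + 1) (Suc k))))
     (slit_rect 1 y)"
    by (intro has_contour_integral_diff integral_slit_fun_power_cauchy x has_contour_integral_sum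
        has_contour_integral_div has_contour_integral_lmul integral_slit_fun_power) auto
  also have "(\<Sum>k<K. (\<Sum>l=1..Suc k. of_nat (stirling (Suc k) l) * (2 * of_real pi * \<i> * (hc (Suc (l + a - 1)) * bern_line y ^ Suc (l + a - 1)))) / pochhammer (of_real x + 1) (Suc k))
     = 2 * of_real pi * \<i> * (\<Sum>k<K. (\<Sum>l=1..Suc k. of_nat (stirling (Suc k) l) * (hc (l + a) * bern_line y ^ (l + a))) / pochhammer (of_real x + 1) (Suc k))"
    unfolding sum_distrib_left times_divide_eq_right
    by (intro sum.cong refl arg_cong2[where f = "(/)"]) (auto simp: mult_ac)
  finally have "((\<lambda>w. slit_fun y w * w ^ a / (of_real x - w) -
         (\<Sum>k<K. (\<Sum>l=1..Suc k. of_nat (stirling (Suc k) l) * (slit_fun y w * w ^ (l + a - 1))) / pochhammer (of_real x + 1) (Suc k)))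
     has_contour_integral (2 * of_real pi * \<i> * remainder x a K y)) (slit_rect 1 y)"
    by (simp only: remainder_def right_diff_distrib)
  thus ?thesis
  proof (rule has_contour_integral_eq)
    fix w assume w: "w \<in> path_image (slit_rect 1 y)"
    have ne: "of_real x \<noteq> w" using w x by (auto simp: path_image_slit_rect)
    have "w \<noteq> 0" using slit_rect_avoids_seg[OF _ w] by (auto simp: seg_def)
    have "(\<Sum>k<K. (\<Sum>l=1..Suc k. of_nat (stirling (Suc k) l) * (slit_fun y w * w ^ (l + a - 1))) / pochhammer (of_real x + 1) (Suc k))
       = slit_fun y w * w ^ a * (\<Sum>k<K. pochhammer (w + 1) k / pochhammer (of_real x + 1) (Suc k))"
      unfolding sum_distrib_left
    proof (intro sum.cong refl)
      fix k
      have "(\<Sum>l=1..Suc k. of_nat (stirling (Suc k) l) * (slit_fun y w * w ^ (l + a - 1))) = slit_fun y w * (w ^ a * pochhammer (w + 1) k)"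
        unfolding pochhammer_plus1_conv_stirling[OF \<open>w \<noteq> 0\<close>] sum_distrib_left by (intro sum.cong refl) (simp only: mult_ac)
      thus "(\<Sum>l=1..Suc k. of_nat (stirling (Suc k) l) * (slit_fun y w * w ^ (l + a - 1))) / pochhammer (of_real x + 1) (Suc k) =
         slit_fun y w * w ^ a * (pochhammer (w + 1) k / pochhammer (of_real x + 1) (Suc k))"
        by (simp only: times_divide_eq_right mult.assoc)
    qed
    also have "(\<Sum>k<K. pochhammer (w + 1) k / pochhammer (of_real x + 1) (Suc k)) = (1 - pochhammer (w + 1) K / pochhammer (of_real x + 1) K) / (of_real x - w)"
      by (rule sum_pochhammer_quotient[OF ne pochhammer_real_nonzero[OF x]])
    finally show "slit_fun y w * w ^ a / (of_real x - w) -
         (\<Sum>k<K. (\<Sum>l=1..Suc k. of_nat (stirling (Suc k) l) * (slit_fun y w * w ^ (l + a - 1))) / pochhammer (of_real x + 1) (Suc k))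
      = slit_fun y w * w ^ a * (pochhammer (w + 1) K / pochhammer (of_real x + 1) K) / (of_real x - w)"
      by (simp only: times_divide_eq_right diff_divide_distrib right_diff_distrib mult_1_right) simp
  qed
qed

text \<open>With \<open>W = bern_line y\<close> the argument of \<open>h\<close> is
  \<open>(w + W) / w\<close>, and the contour keeps distance at least \<open>1/4\<close> from both
  ends \<open>0\<close> and \<open>- W\<close>. Numerator and denominator lie between
  \<open>1/4\<close> and \<open>2 |y| + 7/4\<close> in norm, so \<open>R = 8 (|y| + 1)\<close>
  bounds the quotient and its reciprocal.\<close>

lemma norm_slit_fun_le:
  assumes w: "w \<in> path_image (slit_rect 1 y)"
  shows "norm (slit_fun y w) \<le> C * (8 * (\<bar>y\<bar> + 1)) ^ N"
  unfolding slit_fun_def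
proof (rule slit_boundedD[OF slit])
  note w' = w[unfolded path_image_slit_rect[OF zero_less_one]]
  have notin: "w \<notin> seg y" by (rule slit_rect_avoids_seg[OF _ w]) simp
  show "1 + bern_line y / w \<notin> \<real>\<^sub>\<le>\<^sub>0" by (rule not_nonpos_Reals[OF notin])
  show "1 \<le> 8 * (\<bar>y\<bar> + 1)" by simp
  have nw: "1 / 4 \<le> norm w" using norm_slit_rect_ge[OF _ w] by simp
  have w0: "w \<noteq> 0" using nw by auto
  have nw2: "norm w \<le> 3 / 4 + (\<bar>y\<bar> + 1)"
    using cmod_le[of w] w' by (auto simp: abs_le_iff)
  have "1 / 4 \<le> norm (w + bern_line y)"
  proof -
    have "1 / 4 \<le> \<bar>Re (w + bern_line y)\<bar> \<or> 1 / 4 \<le> \<bar>Im (w + bern_line y)\<bar>"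
    proof -
      have "1 / 4 \<le> \<bar>Im w + y\<bar>" if "\<bar>Im w\<bar> = \<bar>y\<bar> + 1" using that by arith
      moreover have "1 / 4 \<le> \<bar>Re w + 1 / 2\<bar>" if "Re w = - 3 / 4 \<or> Re w = 1 / 4" using that by auto
      ultimately show ?thesis using w' by auto
    qed
    thus ?thesis using abs_Re_le_cmod[of "w + bern_line y"] abs_Im_le_cmod[of "w + bern_line y"] by linarith
  qed
  moreover have "norm (w + bern_line y) \<le> 3 / 4 + (2 * \<bar>y\<bar> + 1)"
  proof -
    have "\<bar>Re (w + bern_line y)\<bar> \<le> 3 / 4"
    proof -
      have "- 3 / 4 \<le> Re w" "Re w \<le> 1 / 4" using w' by simp_all
      thus ?thesis by (intro abs_leI) simp_all
    qed
    moreover have "\<bar>Im (w + bern_line y)\<bar> \<le> 2 * \<bar>y\<bar> + 1"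
      using w' by simp arith
    ultimately show ?thesis using cmod_le[of "w + bern_line y"] by linarith
  qed
  moreover have eq: "norm (1 + bern_line y / w) = norm (w + bern_line y) / norm w"
    using w0 by (simp add: field_simps flip: norm_divide)
  ultimately show "norm (1 + bern_line y / w) \<le> 8 * (\<bar>y\<bar> + 1)" "1 / (8 * (\<bar>y\<bar> + 1)) \<le> norm (1 + bern_line y / w)"
  proof -
    have "norm (w + bern_line y) / norm w \<le> (3 / 4 + (2 * \<bar>y\<bar> + 1)) / (1 / 4)"
      using nw \<open>norm (w + bern_line y) \<le> _\<close> by (intro frac_le) auto
    thus "norm (1 + bern_line y / w) \<le> 8 * (\<bar>y\<bar> + 1)" unfolding eq by simp
    have "1 / (8 * (\<bar>y\<bar> + 1)) \<le> (1 / 4) / (3 / 4 + (\<bar>y\<bar> + 1))"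
      by (simp add: divide_simps)
    also have "\<dots> \<le> norm (w + bern_line y) / norm w"
      using nw nw2 w0 \<open>1 / 4 \<le> norm (w + bern_line y)\<close> by (intro frac_le) auto
    finally show "1 / (8 * (\<bar>y\<bar> + 1)) \<le> norm (1 + bern_line y / w)" unfolding eq .
  qed
qed

text \<open>Length of the contour times a bound on the integrand. For \<open>e = |y| + 1\<close> the
  length is \<open>2 + 4 e <= 6 e\<close>, and \<open>norm (x - w) >= 3/4\<close>; together they
  supply the one factor \<open>8 e\<close> beyond the exponent \<open>N + a\<close>.\<close>

lemma norm_remainder_le:
  assumes x: "1 \<le> x"
  shows "norm (remainder x a K y) \<le> C * 8 ^ (N + a + 1) * exp (pi / 2) / sqrt (real K + 1) * ((1 + \<bar>y\<bar>) ^ (N + a + 1) * exp (pi * \<bar>y\<bar> / 2))"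
proof -
  define e where "e = \<bar>y\<bar> + 1"
  have e: "1 \<le> e" by (simp add: e_def)
  define A where "A = exp (pi * e / 2) / sqrt (real K + 1)"
  have A: "0 \<le> A" by (simp add: A_def)
  have C: "0 \<le> C" by (rule slit_bounded_nonneg[OF slit])
  let ?g = "\<lambda>w. slit_fun y w * w ^ a * (pochhammer (w + 1) K / pochhammer (of_real x + 1) K) / (of_real x - w)"
  define B where "B = C * (8 * e) ^ N * (8 * e) ^ a * A / (3 / 4)"
  have B: "0 \<le> B" using C A e by (simp add: B_def)
  have bound: "norm (?g w) \<le> B" if w: "w \<in> path_image (slit_rect 1 y)" for w
  proof -
    note w' = w[unfolded path_image_slit_rect[OF zero_less_one]]
    have "norm (slit_fun y w) \<le> C * (8 * e) ^ N"
      using norm_slit_fun_le[OF w] by (simp add: e_def)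
    moreover have "norm w \<le> 8 * e"
      using cmod_le[of w] w' by (auto simp: abs_le_iff e_def)
    hence "norm (w ^ a) \<le> (8 * e) ^ a" unfolding norm_power by (rule power_mono) simp
    moreover have "norm (pochhammer (w + 1) K / pochhammer (of_real x + 1) K) \<le> A"
      unfolding A_def by (rule pochhammer_quotient_bound) (use w' x e in \<open>auto simp: e_def\<close>)
    moreover have "3 / 4 \<le> norm (of_real x - w)"
      using complex_Re_le_cmod[of "of_real x - w"] w' x by simp
    ultimately show ?thesis
      unfolding B_def norm_mult norm_divide[of _ "of_real x - w"] using C A e
      by (intro frac_le mult_mono) auto
  qed
  note int = remainder_integral[OF x, of y a K]
  have "norm (contour_integral (slit_rect 1 y) ?g) \<le> B * (2 * (Re (of_real 1 * Complex (1 / 4) (\<bar>y\<bar> + 1)) - Re (of_real 1 * Complex (- 3 / 4) (- (\<bar>y\<bar> + 1))))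
      + 2 * (Im (of_real 1 * Complex (1 / 4) (\<bar>y\<bar> + 1)) - Im (of_real 1 * Complex (- 3 / 4) (- (\<bar>y\<bar> + 1)))))"
    using int bound B unfolding slit_rect_def
    by (intro norm_contour_integral_rectpath_le) (auto simp: contour_integrable_on_def)
  also have "\<dots> = B * (2 + 4 * e)" by (simp add: e_def)
  also have "\<dots> \<le> B * (6 * e)" using B e by (intro mult_left_mono) auto
  also have "contour_integral (slit_rect 1 y) ?g = 2 * of_real pi * \<i> * remainder x a K y"
    by (rule contour_integral_unique[OF int])
  finally have "2 * pi * norm (remainder x a K y) \<le> B * (6 * e)"
    by (simp add: norm_mult)
  moreover have "1 * norm (remainder x a K y) \<le> 2 * pi * norm (remainder x a K y)"
    using pi_gt3 by (intro mult_right_mono) auto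
  ultimately have "norm (remainder x a K y) \<le> B * (6 * e)" by linarith
  also have "\<dots> = C * (8 * e) ^ (N + a + 1) * A"
    by (simp add: B_def power_add)
  also have "A = exp (pi / 2) * exp (pi * \<bar>y\<bar> / 2) / sqrt (real K + 1)"
    by (simp add: A_def e_def algebra_simps add_divide_distrib flip: exp_add)
  also have "C * (8 * e) ^ (N + a + 1) * (exp (pi / 2) * exp (pi * \<bar>y\<bar> / 2) / sqrt (real K + 1))
     = C * 8 ^ (N + a + 1) * exp (pi / 2) / sqrt (real K + 1) * ((1 + \<bar>y\<bar>) ^ (N + a + 1) * exp (pi * \<bar>y\<bar> / 2))"
    by (simp only: power_mult_distrib) (simp add: e_def add_ac)
  finally show ?thesis .
qed

lemma integrable_slit_fun:
  assumes x: "1 \<le> x"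
  shows "integrable lborel (\<lambda>y. of_real (logistic_density y) * slit_fun y (of_real x))"
proof (rule integrable_logistic)
  have x0: "x \<noteq> 0" using x by simp
  have Re: "1 \<le> Re (1 + bern_line y / of_real x)" for y using x by (simp add: Re_divide_of_real)
  have notin: "1 + bern_line y / of_real x \<notin> \<real>\<^sub>\<le>\<^sub>0" for y
  proof
    assume "1 + bern_line y / of_real x \<in> \<real>\<^sub>\<le>\<^sub>0"
    hence "Re (1 + bern_line y / of_real x) \<le> 0" by (simp only: complex_nonpos_Reals_iff)
    thus False using Re[of y] by linarith
  qed
  have "continuous_on (- \<real>\<^sub>\<le>\<^sub>0) h"
    using slit by (auto simp: slit_bounded_def intro: holomorphic_on_imp_continuous_on)
  thus "continuous_on UNIV (\<lambda>y. slit_fun y (of_real x))"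
    unfolding slit_fun_def
  proof (rule continuous_on_compose2)
    show "(\<lambda>y. 1 + bern_line y / of_real x) ` UNIV \<subseteq> - \<real>\<^sub>\<le>\<^sub>0"
    proof (rule image_subsetI)
      show "1 + bern_line y / of_real x \<in> - \<real>\<^sub>\<le>\<^sub>0" for y
        using notin by simp
    qed
  qed (use x0 in \<open>auto intro!: continuous_intros\<close>)
  show "norm (slit_fun y (of_real x)) \<le> C * 2 ^ N * (1 + \<bar>y\<bar>) ^ N" for y
  proof -
    have "norm (slit_fun y (of_real x)) \<le> C * (2 * (1 + \<bar>y\<bar>)) ^ N"
      unfolding slit_fun_def
    proof (rule slit_boundedD[OF slit])
      show "1 + bern_line y / of_real x \<notin> \<real>\<^sub>\<le>\<^sub>0"
        by (rule notin)
      have "norm (1 + bern_line y / of_real x) \<le> 1 + norm (bern_line y) / x"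
        using norm_triangle_ineq[of 1 "bern_line y / of_real x"] x by (simp add: norm_divide)
      also have "norm (bern_line y) / x \<le> (1 / 2 + \<bar>y\<bar>) / 1"
        using x norm_bern_line_le[of y] by (intro frac_le) auto
      finally show "norm (1 + bern_line y / of_real x) \<le> 2 * (1 + \<bar>y\<bar>)" by simp
      have "1 / (2 * (1 + \<bar>y\<bar>)) \<le> 1" by (simp add: divide_simps)
      also have "1 \<le> norm (1 + bern_line y / of_real x)"
        using Re[of y] complex_Re_le_cmod[of "1 + bern_line y / of_real x"] by linarith
      finally show "1 / (2 * (1 + \<bar>y\<bar>)) \<le> norm (1 + bern_line y / of_real x)" .
    qed auto
    thus ?thesis by (simp only: power_mult_distrib mult.assoc)
  qed
qed

text \<open>Only finite sums are averaged, so the left-hand side is the norm of the mean of the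
  pointwise remainder, and its bound is integrated. Limits in \<open>K\<close> are taken
  afterwards.\<close>

theorem bern_mean_expansion_error:
  assumes x: "1 \<le> x"
  shows "norm (of_real x ^ a * bern_mean (\<lambda>w. h (1 + w / of_real x))
      - (\<Sum>j\<le>a. hc j * bern_mean (\<lambda>w. w ^ j) * of_real x ^ (a - j))
      - (\<Sum>k<K. (\<Sum>l=1..Suc k. of_nat (stirling (Suc k) l) * (hc (l + a) * bern_mean (\<lambda>w. w ^ (l + a)))) / pochhammer (of_real x + 1) (Suc k)))
     \<le> C * expansion_const (N + a) / sqrt (real K + 1)"
proof -
  let ?p = "\<lambda>y. complex_of_real (logistic_density y)"
  let ?I = "\<lambda>g. \<integral>y. ?p y * g y \<partial>lborel"
  have hbi: "has_bochner_integral lborel (\<lambda>y. of_real x ^ a * (?p y * slit_fun y (of_real x))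
      - (\<Sum>j\<le>a. hc j * (?p y * bern_line y ^ j) * of_real x ^ (a - j))
      - (\<Sum>k<K. (\<Sum>l=1..Suc k. of_nat (stirling (Suc k) l) * (hc (l + a) * (?p y * bern_line y ^ (l + a)))) / pochhammer (of_real x + 1) (Suc k)))
     (of_real x ^ a * ?I (\<lambda>y. slit_fun y (of_real x))
      - (\<Sum>j\<le>a. hc j * ?I (\<lambda>y. bern_line y ^ j) * of_real x ^ (a - j))
      - (\<Sum>k<K. (\<Sum>l=1..Suc k. of_nat (stirling (Suc k) l) * (hc (l + a) * ?I (\<lambda>y. bern_line y ^ (l + a)))) / pochhammer (of_real x + 1) (Suc k)))"
    by (intro has_bochner_integral_diff has_bochner_integral_sum has_bochner_integral_mult_right
        has_bochner_integral_mult_left has_bochner_integral_divide has_bochner_integral_integrable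
        integrable_slit_fun x integrable_bern_power)
  have eq: "of_real x ^ a * (?p y * slit_fun y (of_real x))
      - (\<Sum>j\<le>a. hc j * (?p y * bern_line y ^ j) * of_real x ^ (a - j))
      - (\<Sum>k<K. (\<Sum>l=1..Suc k. of_nat (stirling (Suc k) l) * (hc (l + a) * (?p y * bern_line y ^ (l + a)))) / pochhammer (of_real x + 1) (Suc k))
      = ?p y * remainder x a K y" for y
    unfolding remainder_def right_diff_distrib sum_distrib_left times_divide_eq_right
    by (intro arg_cong2[where f = "(-)"] sum.cong refl arg_cong2[where f = "(/)"]) (simp_all only: mult_ac)
  define M where "M = C * 8 ^ (N + a + 1) * exp (pi / 2) / sqrt (real K + 1)"
  have M: "0 \<le> M" using slit_bounded_nonneg[OF slit] by (simp add: M_def)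
  have "norm (\<integral>y. ?p y * remainder x a K y \<partial>lborel) \<le> (\<integral>y. M * (2 * pi * fact (N + a + 1) * exp 1) * exp (- \<bar>y\<bar>) \<partial>lborel)"
  proof (rule order_trans[OF integral_norm_bound integral_mono])
    show "integrable lborel (\<lambda>y. norm (?p y * remainder x a K y))"
      using hbi unfolding eq by (auto simp: has_bochner_integral_iff)
    show "integrable lborel (\<lambda>y. M * (2 * pi * fact (N + a + 1) * exp 1) * exp (- \<bar>y\<bar>))"
      by (intro integrable_mult_right integrable_exp_minus_abs)
    show "norm (?p y * remainder x a K y) \<le> M * (2 * pi * fact (N + a + 1) * exp 1) * exp (- \<bar>y\<bar>)" for y
    proof -
      have "norm (?p y * remainder x a K y) = logistic_density y * norm (remainder x a K y)"
        by (simp add: norm_mult logistic_density_nonneg)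
      also have "\<dots> \<le> logistic_density y * (M * ((1 + \<bar>y\<bar>) ^ (N + a + 1) * exp (pi * \<bar>y\<bar> / 2)))"
        unfolding M_def by (intro mult_left_mono norm_remainder_le x logistic_density_nonneg)
      also have "\<dots> = M * (logistic_density y * ((1 + \<bar>y\<bar>) ^ (N + a + 1) * exp (pi * \<bar>y\<bar> / 2)))"
        by (simp only: mult_ac)
      also have "\<dots> \<le> M * (2 * pi * fact (N + a + 1) * exp 1 * exp (- \<bar>y\<bar>))"
        by (intro mult_left_mono M logistic_density_times_le)
      finally show ?thesis by (simp only: mult_ac)
    qed
  qed
  also have "\<dots> = C * expansion_const (N + a) / sqrt (real K + 1)"
    by (simp add: M_def expansion_const_def)
  finally show ?thesis
    using hbi unfolding eq by (simp add: has_bochner_integral_iff bern_mean_def slit_fun_def)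
qed

end

lemma (in slit_expansion) bern_mean_expansion_sums:
  assumes x: "1 \<le> x"
  shows "(\<lambda>k. (\<Sum>l=1..Suc k. of_nat (stirling (Suc k) l) * (hc (l + a) * bern_mean (\<lambda>w. w ^ (l + a)))) / pochhammer (of_real x + 1) (Suc k))
     sums (of_real x ^ a * bern_mean (\<lambda>w. h (1 + w / of_real x))
      - (\<Sum>j\<le>a. hc j * bern_mean (\<lambda>w. w ^ j) * of_real x ^ (a - j)))"
    (is "?t sums ?s")
proof -
  have "(\<lambda>K. (\<Sum>k<K. ?t k) - ?s) \<longlonglongrightarrow> 0"
  proof (rule Lim_null_comparison)
    have "norm ((\<Sum>k<K. ?t k) - ?s) \<le> C * expansion_const (N + a) / sqrt (real K + 1)" for K
      by (subst norm_minus_commute) (rule bern_mean_expansion_error[OF x])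
    thus "\<forall>\<^sub>F K in sequentially. norm ((\<Sum>k<K. ?t k) - ?s) \<le> C * expansion_const (N + a) / sqrt (real K + 1)"
      by simp
    show "(\<lambda>K. C * expansion_const (N + a) / sqrt (real K + 1)) \<longlonglongrightarrow> 0"
      by real_asymp
  qed
  thus ?thesis by (simp add: sums_def LIM_zero_iff)
qed

subsection \<open>Power functions, logarithm and zeta\<close>

text \<open>Controls the factor by which \<open>norm (v powr M)\<close> differs from
  \<open>norm v powr Re M\<close>.\<close>

lemma minus_Im_times_Arg_le: "- Im M * Arg v \<le> pi * norm M"
proof -
  have "\<bar>Im M * Arg v\<bar> \<le> norm M * pi"
    unfolding abs_mult using mpi_less_Arg[of v] Arg_le_pi[of v]
    by (intro mult_mono abs_Im_le_cmod) auto
  thus ?thesis by (simp add: mult.commute abs_le_iff)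
qed

lemma norm_powr_le:
  fixes v M :: complex
  assumes "1 \<le> R" "norm v \<le> R" "1 / R \<le> norm v"
  shows "norm (v powr M) \<le> exp (pi * norm M) * R powr norm M"
proof -
  have v: "0 < norm v" using assms by (smt (verit) divide_pos_pos)
  have "norm v powr Re M \<le> R powr norm M"
  proof -
    have "norm v powr Re M = exp (Re M * ln (norm v))" using v by (simp add: powr_def)
    also have "Re M * ln (norm v) \<le> \<bar>Re M\<bar> * \<bar>ln (norm v)\<bar>"
      by (metis abs_ge_self abs_mult)
    also have "\<dots> \<le> norm M * ln R"
    proof (intro mult_mono abs_Re_le_cmod)
      have "ln (norm v) \<le> ln R" using v assms by simp
      moreover have "ln (1 / R) \<le> ln (norm v)" using v assms by (subst ln_le_cancel_iff) auto
      moreover have "ln (1 / R) = - ln R" using assms by (simp add: ln_div)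
      ultimately show "\<bar>ln (norm v)\<bar> \<le> ln R" by linarith
    qed auto
    finally show ?thesis using assms by (simp add: powr_def)
  qed
  hence "norm (v powr M) \<le> R powr norm M * exp (pi * norm M)"
    unfolding norm_powr_complex using minus_Im_times_Arg_le[of M v] by (intro mult_mono) auto
  thus ?thesis by (simp only: mult.commute)
qed

text \<open>\<open>N\<close> is just an upper bound of \<open>norm M\<close>, so that one pair of
  constants covers a whole disc of exponents.\<close>

lemma slit_bounded_powr:
  assumes "norm M \<le> real N"
  shows "slit_bounded (exp (pi * real N)) N (\<lambda>v. v powr M)"
  unfolding slit_bounded_def
proof (intro conjI allI impI)
  show "(\<lambda>v. v powr M) holomorphic_on - \<real>\<^sub>\<le>\<^sub>0"
    by (intro holomorphic_intros) auto
  fix v :: complex and R :: real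
  assume R: "1 \<le> R" "norm v \<le> R" "1 / R \<le> norm v"
  have "norm (v powr M) \<le> exp (pi * norm M) * R powr norm M" by (rule norm_powr_le[OF R])
  also have "\<dots> \<le> exp (pi * real N) * R powr real N"
    using assms R by (intro mult_mono powr_mono) auto
  finally show "norm (v powr M) \<le> exp (pi * real N) * R ^ N" using R by (simp add: powr_realpow)
qed

lemma slit_expansion_powr:
  assumes "norm M \<le> real N"
  shows "slit_expansion (exp (pi * real N)) N (\<lambda>v. v powr M) (\<lambda>l. M gchoose l)"
  by unfold_locales (use slit_bounded_powr[OF assms] gen_binomial_complex in auto)

text \<open>The coefficient of index 0 is a division by 0 and thus 0, in agreement with
  \<open>Ln 1 = 0\<close>.\<close>

lemma slit_expansion_Ln: "slit_expansion (1 + pi) 1 Ln (\<lambda>l. - ((-1) ^ l) / of_nat l)"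
proof
  show "slit_bounded (1 + pi) 1 Ln"
    unfolding slit_bounded_def
  proof (intro conjI allI impI)
    fix v :: complex and R :: real
    assume v: "v \<notin> \<real>\<^sub>\<le>\<^sub>0" and R: "1 \<le> R" "norm v \<le> R" "1 / R \<le> norm v"
    have v0: "v \<noteq> 0" "0 < norm v" using v by auto
    have "norm (Ln v) \<le> \<bar>Re (Ln v)\<bar> + \<bar>Im (Ln v)\<bar>" by (rule cmod_le)
    also have "\<bar>Im (Ln v)\<bar> \<le> pi" using v0 mpi_less_Im_Ln[of v] Im_Ln_le_pi[of v] by (auto simp: abs_le_iff)
    also have "\<bar>Re (Ln v)\<bar> \<le> ln R"
    proof -
      have "ln (norm v) \<le> ln R" using v0 R by simp
      moreover have "ln (1 / R) \<le> ln (norm v)" using v0 R by (subst ln_le_cancel_iff) auto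
      moreover have "ln (1 / R) = - ln R" using R by (simp add: ln_div)
      moreover have "Re (Ln v) = ln (norm v)" using v0 by simp
      ultimately show ?thesis by linarith
    qed
    also have "ln R \<le> R" using ln_bound[of R] R by simp
    finally have "norm (Ln v) \<le> R + pi * 1" by simp
    also have "\<dots> \<le> R + pi * R" using R by (intro add_left_mono mult_left_mono) auto
    finally show "norm (Ln v) \<le> (1 + pi) * R ^ 1" by (simp add: algebra_simps)
  qed (intro holomorphic_intros, auto)
  show "(\<lambda>l. - ((-1) ^ l) / of_nat l * z ^ l) sums Ln (1 + z)" if "norm z < 1" for z :: complex
  proof -
    have "(- z) ^ l = (-1) ^ l * z ^ l" for l by (rule power_minus)
    thus ?thesis using Ln_series'[OF that] by simp
  qed
qed

section \<open>Telescoped power sums and the zeta function\<close>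

definition shifted_mean :: "(complex \<Rightarrow> complex) \<Rightarrow> nat \<Rightarrow> complex" where
  "shifted_mean g n = bern_mean (\<lambda>w. g (of_nat n + w))"

lemma sum_deriv_eq_shifted_mean:
  assumes g: "slit_bounded C N g"
  shows "(\<Sum>k=1..n. deriv g (of_nat k)) = shifted_mean g n - shifted_mean g 0"
proof (induction n)
  case (Suc n)
  have "shifted_mean g (Suc n) - shifted_mean g n = deriv g (of_nat (Suc n))"
    using bern_mean_shift[OF g, of "real (Suc n)"] by (simp add: shifted_mean_def)
  thus ?case using Suc by (simp add: algebra_simps)
qed auto

lemma sum_powr_eq_shifted_mean:
  assumes "m \<noteq> -1"
  shows "(\<Sum>k=1..n. of_nat k powr m) = (shifted_mean (\<lambda>v. v powr (m + 1)) n - shifted_mean (\<lambda>v. v powr (m + 1)) 0) / (m + 1)"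
proof -
  obtain N where N: "norm (m + 1) \<le> real N" using real_arch_simple by blast
  have m: "m + 1 \<noteq> 0" using assms by (simp add: add_eq_0_iff2)
  have "shifted_mean (\<lambda>v. v powr (m + 1)) n - shifted_mean (\<lambda>v. v powr (m + 1)) 0 = (\<Sum>k=1..n. deriv (\<lambda>v. v powr (m + 1)) (of_nat k))"
    by (rule sum_deriv_eq_shifted_mean[OF slit_bounded_powr[OF N], symmetric])
  also have "\<dots> = (\<Sum>k=1..n. (m + 1) * of_nat k powr m)"
  proof (intro sum.cong refl)
    fix k assume "k \<in> {1..n}"
    hence "complex_of_nat k \<notin> \<real>\<^sub>\<le>\<^sub>0" by (auto simp: complex_nonpos_Reals_iff)
    from has_field_derivative_powr[OF this, of "m + 1"]
    show "deriv (\<lambda>v. v powr (m + 1)) (complex_of_nat k) = (m + 1) * of_nat k powr m"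
      by (intro DERIV_imp_deriv) simp
  qed
  finally show ?thesis using m by (simp flip: sum_distrib_left)
qed

lemma shifted_mean_powr_conv:
  assumes "1 \<le> n"
  shows "shifted_mean (\<lambda>v. v powr M) n = of_nat n powr M * bern_mean (\<lambda>w. (1 + w / of_nat n) powr M)"
proof -
  have eq: "(of_nat n + w) powr M = of_nat n powr M * (1 + w / of_nat n) powr M" for w :: complex
  proof -
    have "of_nat n + w = of_nat n * (1 + w / of_nat n)" using assms by (simp add: field_simps)
    thus ?thesis using powr_times_real_left[of "of_nat n" "1 + w / of_nat n" M] by simp
  qed
  thus ?thesis
    by (simp only: shifted_mean_def bern_mean_def eq mult.left_commute[of _ "of_nat n powr M"]
        Bochner_Integration.integral_mult_right_zero)
qed

lemma integral_logistic_density: "integrable lborel logistic_density" "(\<integral>y. logistic_density y \<partial>lborel) = 1"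
proof -
  have "integrable lborel (\<lambda>y. complex_of_real (logistic_density y))"
    using integrable_bern_power[of 0] by simp
  thus "integrable lborel logistic_density" by (simp only: complex_of_real_integrable_eq)
  have "complex_of_real (\<integral>y. logistic_density y \<partial>lborel) = 1"
    using bern_mean_1 by (simp add: bern_mean_def)
  thus "(\<integral>y. logistic_density y \<partial>lborel) = 1" by (simp only: of_real_eq_1_iff)
qed

lemma norm_bern_mean_le:
  assumes "\<And>y. norm (g (bern_line y)) \<le> B"
  shows "norm (bern_mean g) \<le> B"
proof -
  have B: "0 \<le> B" using assms[of 0] norm_ge_zero order_trans by blast
  have "norm (bern_mean g) \<le> (\<integral>y. norm (of_real (logistic_density y) * g (bern_line y)) \<partial>lborel)"
    unfolding bern_mean_def by (rule integral_norm_bound)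
  also have "\<dots> \<le> (\<integral>y. logistic_density y * B \<partial>lborel)"
    by (rule integral_mono')
       (use integral_logistic_density B assms in \<open>auto simp: norm_mult logistic_density_nonneg intro!: mult_left_mono\<close>)
  finally show ?thesis using integral_logistic_density by simp
qed

text \<open>For exponents with convergent Dirichlet series the upper end of the telescoped sum
  disappears in the limit, which leaves the mean at \<open>n = 0\<close>.\<close>

lemma shifted_mean_powr_tendsto_0:
  assumes M: "Re M < 0"
  shows "shifted_mean (\<lambda>v. v powr M) \<longlonglongrightarrow> 0"
proof (rule Lim_null_comparison)
  have "norm (shifted_mean (\<lambda>v. v powr M) n) \<le> real n powr Re M * exp (pi * norm M)" if n: "1 \<le> n" for n
    unfolding shifted_mean_def
  proof (rule norm_bern_mean_le)
    fix y
    let ?v = "of_nat n + bern_line y"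
    have "real n \<le> norm ?v" using complex_Re_le_cmod[of ?v] by simp
    hence "norm ?v powr Re M \<le> real n powr Re M"
      using M n by (intro powr_mono2') auto
    thus "norm (?v powr M) \<le> real n powr Re M * exp (pi * norm M)"
      unfolding norm_powr_complex using minus_Im_times_Arg_le[of M ?v] by (intro mult_mono) auto
  qed
  thus "\<forall>\<^sub>F n in sequentially. norm (shifted_mean (\<lambda>v. v powr M) n) \<le> real n powr Re M * exp (pi * norm M)"
    using eventually_ge_at_top[of 1] by (rule eventually_mono[rotated])
  show "(\<lambda>n. real n powr Re M * exp (pi * norm M)) \<longlonglongrightarrow> 0"
    using M by real_asymp
qed

text \<open>The factorial expansion is at hand for \<open>x >= 1\<close>. One application of the
  shift identity trades the mean at 0 for the mean at 1.\<close>

lemma shifted_mean_powr_0: "shifted_mean (\<lambda>v. v powr M) 0 = bern_mean (\<lambda>w. (1 + w) powr M) - M"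
proof -
  obtain N where N: "norm M \<le> real N" using real_arch_simple by blast
  have "deriv (\<lambda>v. v powr M) (complex_of_real 1) = M"
    using has_field_derivative_powr[of 1 M] by (intro DERIV_imp_deriv) (simp add: complex_nonpos_Reals_iff)
  hence "bern_mean (\<lambda>w. (1 + w) powr M) - bern_mean (\<lambda>w. (0 + w) powr M) = M"
    using bern_mean_shift[OF slit_bounded_powr[OF N], of 1] by simp
  thus ?thesis by (simp add: shifted_mean_def algebra_simps)
qed

lemma gbinomial_holomorphic [holomorphic_intros]:
  "(\<lambda>M. M gchoose l) holomorphic_on A"
  unfolding gbinomial_prod_rev by (intro holomorphic_intros) auto

text \<open>
  The partial sums of the factorial series at \<open>x = 1\<close> are polynomials in the exponent and converge
  locally uniformly, which avoids differentiating under the integral.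
\<close>

lemma shifted_mean_powr_0_holomorphic:
  "(\<lambda>M. shifted_mean (\<lambda>v. v powr M) 0) holomorphic_on UNIV"
proof -
  define G where "G = (\<lambda>K M. (M gchoose 0) * bern_mean (\<lambda>w. w ^ 0)
     + (\<Sum>k<K. (\<Sum>l=1..Suc k. of_nat (stirling (Suc k) l) * ((M gchoose l) * bern_mean (\<lambda>w. w ^ l))) / pochhammer (of_real 1 + 1) (Suc k)))"
  have pz: "pochhammer (complex_of_real 1 + 1) (Suc k) \<noteq> 0" for k
    by (rule pochhammer_real_nonzero) simp
  have "(\<lambda>M. bern_mean (\<lambda>w. (1 + w) powr M)) holomorphic_on UNIV"
  proof (rule holomorphic_uniform_sequence[of _ G])
    show "G K holomorphic_on UNIV" for K
      unfolding G_def using pz by (intro holomorphic_intros) auto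
    fix M0 :: complex
    \<comment> \<open>This \<open>N\<close> serves all exponents in the unit disc around
      \<open>M0\<close>, so the error bound is uniform there.\<close>
    obtain N where N: "norm M0 + 1 \<le> real N" using real_arch_simple by blast
    have "uniform_limit (cball M0 1) G (\<lambda>M. bern_mean (\<lambda>w. (1 + w) powr M)) sequentially"
    proof (rule uniform_limitI)
      fix \<epsilon> :: real assume \<epsilon>: "\<epsilon> > 0"
      have "(\<lambda>K. exp (pi * real N) * expansion_const N / sqrt (real K + 1)) \<longlonglongrightarrow> 0" by real_asymp
      hence "\<forall>\<^sub>F K in sequentially. exp (pi * real N) * expansion_const N / sqrt (real K + 1) < \<epsilon>"
        using \<epsilon> by (rule order_tendstoD)
      thus "\<forall>\<^sub>F K in sequentially. \<forall>M\<in>cball M0 1. dist (G K M) (bern_mean (\<lambda>w. (1 + w) powr M)) < \<epsilon>"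
      proof eventually_elim
        case (elim K)
        show ?case
        proof
          fix M assume M: "M \<in> cball M0 1"
          have "norm M \<le> norm M0 + norm (M - M0)" by (rule norm_triangle_sub)
          also have "\<dots> \<le> real N" using M N by (simp add: dist_norm norm_minus_commute)
          finally have "norm M \<le> real N" .
          from slit_expansion.bern_mean_expansion_error[OF slit_expansion_powr[OF this], of 1 0 K]
          have "norm (bern_mean (\<lambda>w. (1 + w) powr M) - G K M) \<le> exp (pi * real N) * expansion_const N / sqrt (real K + 1)"
            by (simp add: G_def algebra_simps)
          thus "dist (G K M) (bern_mean (\<lambda>w. (1 + w) powr M)) < \<epsilon>"
            using elim by (simp add: dist_norm norm_minus_commute)
        qed
      qed
    qed
    thus "\<exists>d>0. cball M0 d \<subseteq> UNIV \<and> uniform_limit (cball M0 d) G (\<lambda>M. bern_mean (\<lambda>w. (1 + w) powr M)) sequentially"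
      by (intro exI[of _ 1]) auto
  qed auto
  thus ?thesis unfolding shifted_mean_powr_0 by (intro holomorphic_intros)
qed

text \<open>
  Jensen's formula \<open>zeta s = E (w powr (1 - s)) / (s - 1)\<close>, which also provides the analytic
  continuation of the Dirichlet series.
\<close>

lemma zeta_eq_shifted_mean:
  assumes "m \<noteq> -1"
  shows "zeta (- m) = - shifted_mean (\<lambda>v. v powr (m + 1)) 0 / (m + 1)"
proof -
  define F where "F = (\<lambda>s. - shifted_mean (\<lambda>v. v powr (1 - s)) 0 / (1 - s))"
  have "zeta (- m) = F (- m)"
  proof (rule zeta_eqI)
    have "((\<lambda>M. shifted_mean (\<lambda>v. v powr M) 0) \<circ> (\<lambda>s. 1 - s)) holomorphic_on (- {1})"
      by (rule holomorphic_on_compose[OF _ holomorphic_on_subset[OF shifted_mean_powr_0_holomorphic]])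
         (auto intro!: holomorphic_intros)
    thus "F holomorphic_on - {1}"
      unfolding F_def by (intro holomorphic_intros) (auto simp: o_def)
    fix s :: complex assume s: "Re s > 1"
    have "(\<Sum>k<n. 1 / of_nat (Suc k) powr s) = (shifted_mean (\<lambda>v. v powr (1 - s)) n - shifted_mean (\<lambda>v. v powr (1 - s)) 0) / (1 - s)" for n
    proof -
      have "(\<Sum>k<n. 1 / of_nat (Suc k) powr s) = (\<Sum>k=1..n. of_nat k powr (- s))"
        by (rule sum.reindex_bij_witness[of _ "\<lambda>k. k - 1" Suc]) (auto simp: powr_minus field_simps)
      moreover have "- s \<noteq> - 1" using s by auto
      ultimately show ?thesis using sum_powr_eq_shifted_mean[of "- s" n] by simp
    qed
    moreover have "(\<lambda>n. (shifted_mean (\<lambda>v. v powr (1 - s)) n - shifted_mean (\<lambda>v. v powr (1 - s)) 0) / (1 - s))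
        \<longlonglongrightarrow> (0 - shifted_mean (\<lambda>v. v powr (1 - s)) 0) / (1 - s)"
      using s by (intro tendsto_intros shifted_mean_powr_tendsto_0) auto
    ultimately have "(\<lambda>k. 1 / of_nat (Suc k) powr s) sums F s"
      by (simp add: sums_def F_def)
    thus "F s = (\<Sum>n. 1 / of_nat (Suc n) powr s)" by (rule sums_unique)
  qed (use assms in \<open>auto simp: minus_equation_iff\<close>)
  thus ?thesis by (simp add: F_def add.commute)
qed

subsection \<open>The expansions of the power sums\<close>

text \<open>The sign \<open>(-1) ^ (l + a)\<close> of the moment meets the sign
  \<open>(-1) ^ (K + l)\<close> between unsigned and signed Stirling numbers; the dependence on
  \<open>l\<close> cancels.\<close>

lemma expansion_term_conv:
  "(\<Sum>l=1..K. of_nat (stirling K l) * (c (l + a) * bern_mean (\<lambda>w. w ^ (l + a)))) / pochhammer (of_real (real n) + 1) K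
    = (-1) ^ (K + a) * (\<Sum>l=1..K. c (l + a) * bernoulli (l + a) * of_int (stirling1 K l)) / (\<Prod>j=1..K. of_nat (n + j))"
proof -
  have "pochhammer (of_real (real n) + 1) K = (\<Prod>j=1..K. complex_of_nat (n + j))"
    unfolding pochhammer_prod
    by (rule prod.reindex_bij_witness[of _ "\<lambda>j. j - 1" Suc]) (auto simp: add_ac)
  moreover have "(\<Sum>l=1..K. of_nat (stirling K l) * (c (l + a) * bern_mean (\<lambda>w. w ^ (l + a))))
     = (-1) ^ (K + a) * (\<Sum>l=1..K. c (l + a) * bernoulli (l + a) * of_int (stirling1 K l))"
    unfolding sum_distrib_left
  proof (intro sum.cong refl)
    fix l
    have "(-1) ^ (l + a) = ((-1) ^ (K + a) * (-1) ^ (K + l) :: complex)"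
      by (cases "even K") (simp_all add: power_add)
    thus "of_nat (stirling K l) * (c (l + a) * bern_mean (\<lambda>w. w ^ (l + a))) =
        (-1) ^ (K + a) * (c (l + a) * bernoulli (l + a) * of_int (stirling1 K l))"
      by (simp add: bern_mean_power stirling1_conv_stirling mult_ac)
  qed
  ultimately show ?thesis by simp
qed

lemma sum_powr_expansion:
  fixes m :: complex and a n :: nat
  assumes n: "1 \<le> n" and m: "m \<noteq> -1"
  defines "T \<equiv> (\<lambda>k. (-1) ^ (k + a) *
             (\<Sum>l=1..k. ((m + 1) gchoose (l + a)) * bernoulli (l + a) * of_int (stirling1 k l)) /
             (\<Prod>j=1..k. of_nat (n + j)))"
  shows "summable (\<lambda>k. T (Suc k))"
    "(\<Sum>k=1..n. of_nat k powr m) =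
            1 / (m + 1) * of_nat n powr (m + 1) + zeta (- m)
            + 1 / (m + 1) * (\<Sum>k=1..a. (-1) ^ k * ((m + 1) gchoose k) * bernoulli k
                                * of_nat n powr (m - of_nat k + 1))
            + of_nat n powr (m - of_nat a + 1) / (m + 1) * (\<Sum>k. T (Suc k))"
proof -
  define M where "M = m + 1"
  have M: "M \<noteq> 0" using m by (simp add: M_def add_eq_0_iff2)
  obtain N where "norm M \<le> real N" using real_arch_simple by blast
  then interpret slit_expansion "exp (pi * real N)" N "\<lambda>v. v powr M" "\<lambda>l. M gchoose l"
    by (rule slit_expansion_powr)
  define BM where "BM = bern_mean (\<lambda>w. (1 + w / of_nat n) powr M)"
  have n0: "complex_of_nat n \<noteq> 0" using n by simp
  have "(\<lambda>k. T (Suc k)) sums (of_nat n ^ a * BM - (\<Sum>j\<le>a. (M gchoose j) * bern_mean (\<lambda>w. w ^ j) * of_nat n ^ (a - j)))"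
    using bern_mean_expansion_sums[of "real n" a] n
    unfolding expansion_term_conv by (simp add: T_def BM_def M_def)
  hence T: "summable (\<lambda>k. T (Suc k))"
    "(\<Sum>k. T (Suc k)) = of_nat n ^ a * BM - (\<Sum>j\<le>a. (M gchoose j) * bern_mean (\<lambda>w. w ^ j) * of_nat n ^ (a - j))"
    by (auto simp: sums_iff)
  show "summable (\<lambda>k. T (Suc k))" by (rule T)
  have powr: "of_nat n powr (m - of_nat k + 1) = of_nat n powr M / of_nat n ^ k" for k
  proof -
    have eq: "m - of_nat k + 1 = M - of_nat k" by (simp add: M_def)
    show ?thesis unfolding eq powr_diff using n0 by (simp add: powr_nat')
  qed
  have "(\<Sum>j\<le>a. (M gchoose j) * bern_mean (\<lambda>w. w ^ j) * of_nat n ^ (a - j))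
      = of_nat n ^ a * (\<Sum>j\<le>a. (-1) ^ j * (M gchoose j) * bernoulli j / of_nat n ^ j)"
    unfolding sum_distrib_left
    by (intro sum.cong refl) (use n0 in \<open>auto simp: bern_mean_power power_diff mult_ac\<close>)
  \<comment> \<open>The term \<open>j = 0\<close> yields the leading power
    \<open>n ^ (m + 1) / (m + 1)\<close>, the others the Bernoulli terms.\<close>
  also have "(\<Sum>j\<le>a. (-1) ^ j * (M gchoose j) * bernoulli j / of_nat n ^ j) = 1 + (\<Sum>j=1..a. (-1) ^ j * (M gchoose j) * bernoulli j / of_nat n ^ j)"
    by (simp add: bernoulli_0 atMost_atLeast0 sum.atLeast_Suc_atMost)
  finally have S: "(\<Sum>j\<le>a. (M gchoose j) * bern_mean (\<lambda>w. w ^ j) * of_nat n ^ (a - j))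
      = of_nat n ^ a * (1 + (\<Sum>j=1..a. (-1) ^ j * (M gchoose j) * bernoulli j / of_nat n ^ j))" .
  have "of_nat n ^ a * BM = of_nat n ^ a * (1 + (\<Sum>j=1..a. (-1) ^ j * (M gchoose j) * bernoulli j / of_nat n ^ j)) + (\<Sum>k. T (Suc k))"
    using T(2) unfolding S by simp
  also have "\<dots> = of_nat n ^ a * (1 + (\<Sum>j=1..a. (-1) ^ j * (M gchoose j) * bernoulli j / of_nat n ^ j) + (\<Sum>k. T (Suc k)) / of_nat n ^ a)"
    using n0 by (simp add: field_simps)
  finally have BM: "BM = 1 + (\<Sum>j=1..a. (-1) ^ j * (M gchoose j) * bernoulli j / of_nat n ^ j) + (\<Sum>k. T (Suc k)) / of_nat n ^ a"
    using n0 by simp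
  have "(\<Sum>k=1..n. of_nat k powr m) = of_nat n powr M * BM / M + zeta (- m)"
    unfolding sum_powr_eq_shifted_mean[OF m] zeta_eq_shifted_mean[OF m] shifted_mean_powr_conv[OF n]
    by (simp add: BM_def M_def diff_divide_distrib)
  also have "of_nat n powr M * BM = of_nat n powr M + (\<Sum>j=1..a. (-1) ^ j * (M gchoose j) * bernoulli j * of_nat n powr (m - of_nat j + 1))
       + of_nat n powr (m - of_nat a + 1) * (\<Sum>k. T (Suc k))"
    unfolding BM powr by (simp add: distrib_left sum_distrib_left mult_ac)
  finally show "(\<Sum>k=1..n. of_nat k powr m) =
            1 / (m + 1) * of_nat n powr (m + 1) + zeta (- m)
            + 1 / (m + 1) * (\<Sum>k=1..a. (-1) ^ k * ((m + 1) gchoose k) * bernoulli k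
                                * of_nat n powr (m - of_nat k + 1))
            + of_nat n powr (m - of_nat a + 1) / (m + 1) * (\<Sum>k. T (Suc k))"
    by (simp add: M_def add_divide_distrib)
qed

section \<open>The harmonic sum and Euler's constant\<close>

lemma harmonic_sum_eq_shifted_mean:
  "(\<Sum>k=1..n. 1 / of_nat k) = shifted_mean Ln n - shifted_mean Ln 0"
proof -
  interpret slit_expansion "1 + pi" 1 Ln "\<lambda>l. - ((-1) ^ l) / of_nat l"
    by (rule slit_expansion_Ln)
  have "(\<Sum>k=1..n. 1 / of_nat k) = (\<Sum>k=1..n. deriv Ln (of_nat k))"
  proof (intro sum.cong refl)
    fix k assume "k \<in> {1..n}"
    hence "complex_of_nat k \<notin> \<real>\<^sub>\<le>\<^sub>0" by (auto simp: complex_nonpos_Reals_iff)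
    thus "1 / of_nat k = deriv Ln (of_nat k)"
      by (intro DERIV_imp_deriv[symmetric]) (auto intro!: derivative_eq_intros simp: field_simps)
  qed
  thus ?thesis using sum_deriv_eq_shifted_mean[OF slit] by simp
qed

lemma shifted_mean_Ln_conv:
  assumes "1 \<le> n"
  shows "shifted_mean Ln n = of_real (ln (real n)) + bern_mean (\<lambda>w. Ln (1 + w / of_nat n))"
proof -
  interpret slit_expansion "1 + pi" 1 Ln "\<lambda>l. - ((-1) ^ l) / of_nat l"
    by (rule slit_expansion_Ln)
  have eq: "Ln (of_nat n + bern_line y) = of_real (ln (real n)) + Ln (1 + bern_line y / of_nat n)" for y
  proof -
    have "1 + bern_line y / of_nat n \<noteq> 0"
      using assms by (auto simp: complex_eq_iff Re_divide_of_nat add_eq_0_iff2 field_simps)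
    moreover have "of_nat n + bern_line y = of_real (real n) * (1 + bern_line y / of_nat n)"
      using assms by (simp add: field_simps)
    ultimately show ?thesis using assms Ln_times_of_real[of "real n" "1 + bern_line y / of_nat n"] by simp
  qed
  have "integrable lborel (\<lambda>y. of_real (logistic_density y) * Ln (1 + bern_line y / of_nat n))"
    using integrable_slit_fun[of "real n"] assms by (simp add: slit_fun_def)
  moreover have "integrable lborel (\<lambda>y. complex_of_real (logistic_density y) * of_real (ln (real n)))"
    using integrable_bern_power[of 0] by (intro integrable_mult_left) simp
  ultimately have "shifted_mean Ln n = (\<integral>y. of_real (logistic_density y) * of_real (ln (real n)) \<partial>lborel) + bern_mean (\<lambda>w. Ln (1 + w / of_nat n))"
    unfolding shifted_mean_def bern_mean_def eq distrib_left by (intro Bochner_Integration.integral_add)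
  also have "(\<integral>y. of_real (logistic_density y) * of_real (ln (real n)) \<partial>lborel) = complex_of_real (ln (real n))"
    using bern_mean_1 by (simp add: bern_mean_def)
  finally show ?thesis .
qed

text \<open>Identified by a limit: the harmonic sum minus \<open>ln n\<close> is the mean of
  \<open>Ln (1 + w / n)\<close> minus this constant, and that mean is of order
  \<open>1 / n\<close>.\<close>

lemma shifted_mean_Ln_0: "shifted_mean Ln 0 = - of_real euler_mascheroni"
proof -
  interpret slit_expansion "1 + pi" 1 Ln "\<lambda>l. - ((-1) ^ l) / of_nat l"
    by (rule slit_expansion_Ln)
  let ?B = "\<lambda>n::nat. bern_mean (\<lambda>w. Ln (1 + w / of_nat n))"
  define c where "c = (1 + pi) * expansion_const 2 + 1"
  have "norm (?B n) \<le> c / real n" if n: "1 \<le> n" for n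
  proof -
    \<comment> \<open>The error bound with \<open>a = 1\<close> and \<open>K = 0\<close>: the sum
      over \<open>k\<close> is empty, \<open>1/2\<close> is the first moment, and the index 2 is
      \<open>N + a\<close>.\<close>
    have "norm (of_nat n * ?B n - 1 / 2) \<le> (1 + pi) * expansion_const 2"
      using bern_mean_expansion_error[of "real n" 1 0] n by (simp add: bern_mean_power bernoulli_1 numeral_2_eq_2)
    moreover have "norm (of_nat n * ?B n) \<le> norm (of_nat n * ?B n - 1 / 2) + norm (1 / 2 :: complex)"
      by (metis diff_add_cancel norm_triangle_ineq)
    ultimately have "real n * norm (?B n) \<le> c" unfolding c_def norm_mult by simp
    thus ?thesis using n by (simp add: field_simps)
  qed
  hence "\<forall>\<^sub>F n in sequentially. norm (?B n) \<le> c / real n"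
    using eventually_ge_at_top[of 1] by (rule eventually_mono[rotated])
  moreover have "(\<lambda>n. c / real n) \<longlonglongrightarrow> 0" by real_asymp
  ultimately have "?B \<longlonglongrightarrow> 0" by (rule Lim_null_comparison)
  moreover have "(\<lambda>n. complex_of_real (harm n - ln (real n))) \<longlonglongrightarrow> of_real euler_mascheroni"
    by (intro tendsto_of_real euler_mascheroni_LIMSEQ)
  ultimately have lim: "(\<lambda>n. complex_of_real (harm n - ln (real n)) - ?B n) \<longlonglongrightarrow> of_real euler_mascheroni - 0"
    by (intro tendsto_diff)
  have "\<forall>\<^sub>F n in sequentially. complex_of_real (harm n - ln (real n)) - ?B n = - shifted_mean Ln 0"
    using eventually_ge_at_top[of 1]
  proof eventually_elim
    case (elim n)
    have "complex_of_real (harm n) = (\<Sum>k=1..n. 1 / of_nat k)"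
      by (simp add: harm_def field_simps)
    also have "\<dots> = of_real (ln (real n)) + ?B n - shifted_mean Ln 0"
      unfolding harmonic_sum_eq_shifted_mean shifted_mean_Ln_conv[OF elim] ..
    finally show ?case by simp
  qed
  hence "(\<lambda>n. complex_of_real (harm n - ln (real n)) - ?B n) \<longlonglongrightarrow> - shifted_mean Ln 0"
    by (rule tendsto_eventually)
  from LIMSEQ_unique[OF this lim] have "- shifted_mean Ln 0 = of_real euler_mascheroni"
    by (simp only: diff_zero)
  thus ?thesis by (simp only: minus_equation_iff[of "shifted_mean Ln 0"])
qed

lemma harmonic_expansion:
  fixes a n :: nat
  assumes n: "1 \<le> n"
  defines "T \<equiv> (\<lambda>k. (-1) ^ (k + 1) *
             (\<Sum>l=1..k. (-1) ^ l / real (l + a) * bernoulli (l + a) * of_int (stirling1 k l)) /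
             (\<Prod>j=1..k. real (n + j)))"
  shows "summable (\<lambda>k. T (Suc k))"
    "(\<Sum>k=1..n. 1 / real k) =
            ln (real n) + euler_mascheroni - (\<Sum>k=1..a. bernoulli k / (real k * real n ^ k))
            + 1 / real n ^ a * (\<Sum>k. T (Suc k))"
proof -
  interpret slit_expansion "1 + pi" 1 Ln "\<lambda>l. - ((-1) ^ l) / of_nat l"
    by (rule slit_expansion_Ln)
  define r where "r = (\<Sum>k=1..n. 1 / real k) - ln (real n) - euler_mascheroni"
  have n0: "real n \<noteq> 0" using n by simp
  have BM: "bern_mean (\<lambda>w. Ln (1 + w / of_nat n)) = of_real r"
  proof -
    have "complex_of_real (\<Sum>k=1..n. 1 / real k) = shifted_mean Ln n - shifted_mean Ln 0"
      unfolding harmonic_sum_eq_shifted_mean [symmetric] by simp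
    thus ?thesis by (simp add: r_def shifted_mean_Ln_conv[OF n] shifted_mean_Ln_0)
  qed
  have term_eq: "(-1) ^ (K + a) * (\<Sum>l=1..K. - ((-1) ^ (l + a)) / of_nat (l + a) * bernoulli (l + a) * of_int (stirling1 K l)) / (\<Prod>j=1..K. of_nat (n + j))
      = complex_of_real (T K)" for K
  proof -
    have "(-1) ^ (K + a) * (\<Sum>l=1..K. - ((-1) ^ (l + a)) / of_nat (l + a) * bernoulli (l + a) * of_int (stirling1 K l))
      = (-1) ^ (K + 1) * (\<Sum>l=1..K. (-1) ^ l / complex_of_nat (l + a) * bernoulli (l + a) * of_int (stirling1 K l))"
      unfolding sum_distrib_left
    proof (intro sum.cong refl)
      fix l
      have "(-1) ^ (K + a) * - ((-1) ^ (l + a)) = ((-1) ^ (K + 1) * (-1) ^ l :: complex)"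
        by (cases "even a") (simp_all add: power_add)
      thus "(-1) ^ (K + a) * (- ((-1) ^ (l + a)) / of_nat (l + a) * bernoulli (l + a) * of_int (stirling1 K l)) =
        (-1) ^ (K + 1) * ((-1) ^ l / complex_of_nat (l + a) * bernoulli (l + a) * of_int (stirling1 K l))"
        by (simp only: times_divide_eq_left times_divide_eq_right mult.assoc [symmetric])
    qed
    thus ?thesis by (simp add: T_def of_real_bernoulli)
  qed
  define s where "s = real n ^ a * (r + (\<Sum>k=1..a. bernoulli k / (real k * real n ^ k)))"
  have "(\<lambda>k. complex_of_real (T (Suc k))) sums (of_nat n ^ a * of_real r
      - (\<Sum>j\<le>a. - ((-1) ^ j) / of_nat j * bern_mean (\<lambda>w. w ^ j) * of_nat n ^ (a - j)))"
    using bern_mean_expansion_sums[of "real n" a] n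
    unfolding expansion_term_conv[where c = "\<lambda>l. - ((-1) ^ l) / of_nat l"] term_eq by (simp add: BM)
  also have "(\<Sum>j\<le>a. - ((-1) ^ j) / of_nat j * bern_mean (\<lambda>w. w ^ j) * of_nat n ^ (a - j))
     = (\<Sum>j\<le>a. - of_real (real n ^ a * (bernoulli j / (real j * real n ^ j))))"
  proof (intro sum.cong refl)
    fix j assume "j \<in> {..a}"
    hence "complex_of_nat n ^ (a - j) = of_nat n ^ a / of_nat n ^ j" using n0 by (simp add: power_diff)
    moreover have "(-1) ^ j * ((-1) ^ j * x) = x" for x :: complex
      by (cases "even j") simp_all
    ultimately show "- ((-1) ^ j) / of_nat j * bern_mean (\<lambda>w. w ^ j) * of_nat n ^ (a - j) = - complex_of_real (real n ^ a * (bernoulli j / (real j * real n ^ j)))"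
      by (simp add: bern_mean_power of_real_bernoulli mult_ac)
  qed
  \<comment> \<open>The term \<open>j = 0\<close> has denominator 0 and is therefore 0.\<close>
  also have "\<dots> = (\<Sum>j=1..a. - of_real (real n ^ a * (bernoulli j / (real j * real n ^ j))))"
    by (simp add: atMost_atLeast0 sum.atLeast_Suc_atMost)
  finally have "(\<lambda>k. complex_of_real (T (Suc k))) sums of_real s"
    by (simp add: s_def sum_negf sum_distrib_left distrib_left)
  hence "(\<lambda>k. T (Suc k)) sums s" by (simp only: sums_of_real_iff)
  hence T: "summable (\<lambda>k. T (Suc k))" "(\<Sum>k. T (Suc k)) = s" by (auto simp: sums_iff)
  show "summable (\<lambda>k. T (Suc k))" by (rule T)
  have "1 / real n ^ a * s = r + (\<Sum>k=1..a. bernoulli k / (real k * real n ^ k))"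
    using n0 by (simp add: s_def)
  thus "(\<Sum>k=1..n. 1 / real k) =
            ln (real n) + euler_mascheroni - (\<Sum>k=1..a. bernoulli k / (real k * real n ^ k))
            + 1 / real n ^ a * (\<Sum>k. T (Suc k))"
    by (simp add: T(2) r_def)
qed

section \<open>Explicit first terms and the combined statement\<close>

lemma stirling1_small:
  "stirling1 1 1 = 1" "stirling1 2 1 = -1" "stirling1 2 2 = 1"
  "stirling1 3 1 = 2" "stirling1 3 2 = -3" "stirling1 3 3 = 1"
  "stirling1 4 1 = -6" "stirling1 4 2 = 11" "stirling1 4 3 = -6" "stirling1 4 4 = 1"
  by (simp_all add: stirling1_conv_stirling eval_nat_numeral)

theorem corollary15:
  fixes n :: nat
  assumes "n \<ge> 1"
  shows
   "(\<forall>m :: complex. m \<noteq> -1 \<longrightarrow>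
      (let T = (\<lambda>k. (-1) ^ k *
             (\<Sum>l=1..k. ((m + 1) gchoose l) * bernoulli l * of_int (stirling1 k l)) /
             (\<Prod>j=1..k. of_nat (n + j)))
       in summable (\<lambda>k. T (Suc k)) \<and>
          (\<Sum>k=1..n. of_nat k powr m) =
            1 / (m + 1) * of_nat n powr (m + 1) + zeta (- m)
            + of_nat n powr (m + 1) / (m + 1) * (\<Sum>k. T (Suc k))))
  \<and> (\<forall>(m :: complex) (a :: nat). m \<noteq> -1 \<longrightarrow>
      (let T = (\<lambda>k. (-1) ^ (k + a) *
             (\<Sum>l=1..k. ((m + 1) gchoose (l + a)) * bernoulli (l + a) * of_int (stirling1 k l)) /
             (\<Prod>j=1..k. of_nat (n + j)))
       in summable (\<lambda>k. T (Suc k)) \<and>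
          (\<Sum>k=1..n. of_nat k powr m) =
            1 / (m + 1) * of_nat n powr (m + 1) + zeta (- m)
            + 1 / (m + 1) * (\<Sum>k=1..a. (-1) ^ k * ((m + 1) gchoose k) * bernoulli k
                                * of_nat n powr (m - of_nat k + 1))
            + of_nat n powr (m - of_nat a + 1) / (m + 1) * (\<Sum>k. T (Suc k))))
  \<and> (\<forall>m :: complex. m \<noteq> -1 \<longrightarrow> Re m \<ge> -1 \<longrightarrow>
      (let a = nat \<lfloor>Re m + 1\<rfloor>;
           T = (\<lambda>k. (-1) ^ k *
             ((\<Sum>l=1..k. ((m + 1) gchoose (l + a)) * bernoulli (l + a) * of_int (stirling1 k l)) /
             (\<Prod>j=1..k. of_nat (n + j))))
       in summable (\<lambda>k. T (Suc k)) \<and>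
          (\<Sum>k=1..n. of_nat k powr m) =
            1 / (m + 1) * of_nat n powr (m + 1) + zeta (- m)
            + 1 / (m + 1) * (\<Sum>k=1..a. (-1) ^ k * ((m + 1) gchoose k) * bernoulli k
                                * of_nat n powr (m - of_nat k + 1))
            + (-1) ^ a * (of_nat n powr (m - of_nat a + 1) / (m + 1)) * (\<Sum>k. T (Suc k))))
  \<and> (\<forall>a :: nat.
      (let T = (\<lambda>k. (-1) ^ (k + 1) *
             (\<Sum>l=1..k. (-1) ^ l / real (l + a) * bernoulli (l + a) * of_int (stirling1 k l)) /
             (\<Prod>j=1..k. real (n + j)))
       in summable (\<lambda>k. T (Suc k)) \<and>
          (\<Sum>k=1..n. 1 / real k) =
            ln (real n) + euler_mascheroni - (\<Sum>k=1..a. bernoulli k / (real k * real n ^ k))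
            + 1 / real n ^ a * (\<Sum>k. T (Suc k))))
  \<and> (let T = (\<lambda>k. (-1) ^ (k + 1) *
             (\<Sum>l=1..k. (-1) ^ l / real l * bernoulli l * of_int (stirling1 k l)) /
             (\<Prod>j=1..k. real (n + j)))
       in summable (\<lambda>k. T (Suc k)) \<and>
          (\<Sum>k=1..n. 1 / real k) = ln (real n) + euler_mascheroni + (\<Sum>k. T (Suc k)) \<and>
          T 1 = 1 / (2 * (real n + 1)) \<and>
          T 2 = 5 / (12 * (real n + 1) * (real n + 2)) \<and>
          T 3 = 3 / (4 * (real n + 1) * (real n + 2) * (real n + 3)) \<and>
          T 4 = 251 / (120 * (real n + 1) * (real n + 2) * (real n + 3) * (real n + 4)))
  \<and> (let T = (\<lambda>k. (-1) ^ k *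
             (\<Sum>l=1..k. bernoulli (l + 1) / real (l + 1) * of_int (stirling1 k l)) /
             (\<Prod>j=0..k. real (n + j)))
       in summable (\<lambda>k. T (Suc k)) \<and>
          (\<Sum>k=1..n. 1 / real k) =
            ln (real n) + euler_mascheroni + 1 / (2 * real n) + (\<Sum>k. T (Suc k)) \<and>
          T 1 = - (1 / (12 * real n * (real n + 1))) \<and>
          T 2 = - (1 / (12 * real n * (real n + 1) * (real n + 2))) \<and>
          T 3 = - (19 / (120 * real n * (real n + 1) * (real n + 2) * (real n + 3))) \<and>
          T 4 = - (9 / (20 * real n * (real n + 1) * (real n + 2) * (real n + 3) * (real n + 4))))"
proof -
  have n0: "real n > 0" using assms by simp
  have B: "bernoulli 1 = (- 1 / 2 :: real)" "bernoulli 3 = (0 :: real)" "bernoulli 5 = (0 :: real)"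
    using bernoulli_1[where 'a = real] by (auto intro!: bernoulli_odd_eq_0)
  have ivl: "{1..2} = {1, 2 :: nat}" "{1..3} = {1, 2, 3 :: nat}" "{1..4} = {1, 2, 3, 4 :: nat}"
    "{0..1} = {0, 1 :: nat}" "{0..2} = {0, 1, 2 :: nat}" "{0..3} = {0, 1, 2, 3 :: nat}" "{0..4} = {0, 1, 2, 3, 4 :: nat}"
    by auto
  note vals = B bernoulli_2 bernoulli_4 stirling1_small ivl
  show ?thesis
  proof (intro conjI allI impI, goal_cases)
    case (1 m)
    show ?case using sum_powr_expansion[OF assms 1, of 0] by (simp add: Let_def)
  next
    case (2 m a)
    show ?case unfolding Let_def using sum_powr_expansion[OF assms 2, of a] by blast
  next
    case (3 m)
    define a where "a = nat \<lfloor>Re m + 1\<rfloor>"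
    define T where "T = (\<lambda>k. (-1) ^ k *
             ((\<Sum>l=1..k. ((m + 1) gchoose (l + a)) * bernoulli (l + a) * of_int (stirling1 k l)) /
             (\<Prod>j=1..k. of_nat (n + j))))"
    have T: "(-1) ^ (k + a) *
             (\<Sum>l=1..k. ((m + 1) gchoose (l + a)) * bernoulli (l + a) * of_int (stirling1 k l)) /
             (\<Prod>j=1..k. of_nat (n + j)) = (-1) ^ a * T k" for k
      by (simp add: T_def power_add)
    note E = sum_powr_expansion[OF assms 3(1), of a, unfolded T]
    have summ: "summable (\<lambda>k. T (Suc k))"
      using E(1) by (simp add: summable_cmult_iff)
    have "of_nat n powr (m - of_nat a + 1) / (m + 1) * (\<Sum>k. (-1) ^ a * T (Suc k))
        = (-1) ^ a * (of_nat n powr (m - of_nat a + 1) / (m + 1)) * (\<Sum>k. T (Suc k))"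
      unfolding suminf_mult[OF summ] by simp
    hence "(\<Sum>k=1..n. of_nat k powr m) =
            1 / (m + 1) * of_nat n powr (m + 1) + zeta (- m)
            + 1 / (m + 1) * (\<Sum>k=1..a. (-1) ^ k * ((m + 1) gchoose k) * bernoulli k
                                * of_nat n powr (m - of_nat k + 1))
            + (-1) ^ a * (of_nat n powr (m - of_nat a + 1) / (m + 1)) * (\<Sum>k. T (Suc k))"
      using E(2) by (simp only:)
    thus ?case using summ unfolding Let_def T_def a_def by blast
  next
    case (4 a)
    show ?case unfolding Let_def using harmonic_expansion[OF assms, of a] by blast
  next
    case 5
    define T where "T = (\<lambda>k. (-1) ^ (k + 1) *
             (\<Sum>l=1..k. (-1) ^ l / real l * bernoulli l * of_int (stirling1 k l)) /
             (\<Prod>j=1..k. real (n + j)))"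
    have T1: "summable (\<lambda>k. T (Suc k))"
      using harmonic_expansion(1)[OF assms, of 0] unfolding T_def add_0_right .
    have T2: "(\<Sum>k=1..n. 1 / real k) = ln (real n) + euler_mascheroni + (\<Sum>k. T (Suc k))"
      using harmonic_expansion(2)[OF assms, of 0] unfolding T_def add_0_right by simp
    have "T 1 = 1 / (2 * (real n + 1))" "T 2 = 5 / (12 * (real n + 1) * (real n + 2))"
      "T 3 = 3 / (4 * (real n + 1) * (real n + 2) * (real n + 3))"
      "T 4 = 251 / (120 * (real n + 1) * (real n + 2) * (real n + 3) * (real n + 4))"
      using n0 by (simp_all add: T_def vals field_simps del: One_nat_def)
    thus ?case using T1 T2 unfolding Let_def T_def by blast
  next
    case 6
    define T where "T = (\<lambda>k. (-1) ^ (k + 1) *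
             (\<Sum>l=1..k. (-1) ^ l / real (l + 1) * bernoulli (l + 1) * of_int (stirling1 k l)) /
             (\<Prod>j=1..k. real (n + j)))"
    \<comment> \<open>The factor \<open>1 / n\<close> of the case \<open>a = 1\<close> extends the
      product down to \<open>j = 0\<close>. The sign \<open>(-1) ^ l\<close> becomes a global minus,
      because the Bernoulli number of index \<open>l + 1\<close> vanishes for even
      \<open>l >= 2\<close>.\<close>
    have T: "(-1) ^ k * (\<Sum>l=1..k. bernoulli (l + 1) / real (l + 1) * of_int (stirling1 k l)) /
             (\<Prod>j=0..k. real (n + j)) = 1 / real n * T k" for k
    proof -
      have "(-1) ^ l / real (l + 1) * bernoulli (l + 1) = - (bernoulli (l + 1) / real (l + 1))" if "l \<in> {1..k}" for l
      proof -
        have "(-1) ^ l * bernoulli (l + 1) = - bernoulli (l + 1 :: nat) / (1 :: real)"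
          using bernoulli_alternating[of "l + 1", where 'a = real] that by simp
        thus ?thesis by (simp only: times_divide_eq_left div_by_1 minus_divide_left)
      qed
      hence "(\<Sum>l=1..k. (-1) ^ l / real (l + 1) * bernoulli (l + 1) * of_int (stirling1 k l))
          = - (\<Sum>l=1..k. bernoulli (l + 1) / real (l + 1) * of_int (stirling1 k l))"
        unfolding sum_negf [symmetric] by (intro sum.cong refl) simp
      moreover have "(\<Prod>j=0..k. real (n + j)) = real n * (\<Prod>j=1..k. real (n + j))"
        by (simp add: prod.atLeast_Suc_atMost)
      ultimately show ?thesis by (simp add: T_def)
    qed
    have E: "summable (\<lambda>k. T (Suc k))"
      "(\<Sum>k=1..n. 1 / real k) = ln (real n) + euler_mascheroni
          - (\<Sum>k=1..1. bernoulli k / (real k * real n ^ k)) + 1 / real n ^ 1 * (\<Sum>k. T (Suc k))"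
      using harmonic_expansion[OF assms, of 1] unfolding T_def .
    have T1: "summable (\<lambda>k. 1 / real n * T (Suc k))"
      using E(1) by (rule summable_mult)
    \<comment> \<open>The single Bernoulli term for \<open>a = 1\<close> is
      \<open>- B_1 / n = 1 / (2 n)\<close>.\<close>
    have T2: "(\<Sum>k=1..n. 1 / real k) = ln (real n) + euler_mascheroni + 1 / (2 * real n) + (\<Sum>k. 1 / real n * T (Suc k))"
      using E(2) unfolding suminf_mult[OF E(1)] by (simp add: bernoulli_1)
    have "1 / real n * T 1 = - (1 / (12 * real n * (real n + 1)))"
      "1 / real n * T 2 = - (1 / (12 * real n * (real n + 1) * (real n + 2)))"
      "1 / real n * T 3 = - (19 / (120 * real n * (real n + 1) * (real n + 2) * (real n + 3)))"
      "1 / real n * T 4 = - (9 / (20 * real n * (real n + 1) * (real n + 2) * (real n + 3) * (real n + 4)))"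
      using n0 by (simp_all add: T_def vals field_simps del: One_nat_def)
    thus ?case using T1 T2 unfolding Let_def T by blast
  qed
qed

end
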